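(* Let $\mathbf k$ be an infinite field, let $\mathcal L\subseteq\mathbb Z^n$ be a sublattice of rank two, and let $I$ and $J$ be two monomial initial ideals of $I_{\mathcal L}\subseteq S=\mathbf k[x_1,\dots,x_n]$ which differ by a flip. Then the wall ideal $W$ of $I$ and $J$ is coherent.
   Context: $S$ is graded by $G=\mathbb Z^n/\mathcal L$ via $\deg(x_i)=e_i+\mathcal L$; $G^+$ is the image of $\mathbb N^n$ in $G$. A homogeneous ideal $I\subseteq S$ is $\mathcal L$-graded if $\dim_{\mathbf k}((S/I)_g)=1$ for all $g\in G^+$. The lattice ideal is $I_{\mathcal L}=\langle x^{u^+}-x^{u^-} : u\in\mathcal L\rangle$, where $u=u^+-u^-$ is the decomposition into positive and negative parts. For $w\in\mathbb Z^n$, $in_w(I_{\mathcal L})$ is the ideal generated by the initial forms $in_w(f)$, $0\ne f\in I_{\mathcal L}$, where $in_w(f)$ is the sum of the terms of $f$ of maximal $w$-weight. The monomial initial ideals of $I_{\mathcal L}$ considered here are $\mathcal L$-graded. Coherent: an $\mathcal L$-graded ideal $J$ is coherent if there are $w\in\mathbb Z^n$ and $\lambda\in(\mathbf k^* )^n$ with $J=\lambda\cdot in_w(I_{\mathcal L})$, where $(\mathbf k^* )^n$ acts by scaling the variables. Flips and wall ideals: let $M_1$ be a monomial $\mathcal L$-graded ideal with minimal generator $x^u$, and let $x^v$ be the unique monomial not in $M_1$ of the same $\mathcal L$-degree as $x^u$. The wall ideal $W$ associated to $M_1$ and $x^u$ is the ideal obtained from the minimal monomial generating set of $M_1$ by replacing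 the generator $x^u$ by the binomial $x^u-x^v$. The binomial $x^u-x^v$ is flippable if $in_{\prec}(W)=M_1$ for any term order $\prec$ with $x^v\prec x^u$. If $x^u-x^v$ is flippable and there is also a term order $\prec'$ with $x^u\prec' x^v$, set $M_2=in_{\prec'}(W)$, a monomial $\mathcal L$-graded ideal; then $M_1$ and $M_2$ are said to differ by a flip (over $x^u-x^v$), and $W$ is called the wall ideal of $M_1$ and $M_2$. (Term orders are monomial orders on $S$ with $1$ as smallest monomial.) *)

theory Defs
  imports "HOL-Analysis.Finite_Cartesian_Product" "HOL-Library.Poly_Mapping"
begin

section \<open>The polynomial ring\<close>

text \<open>Exponent vectors are elements of \<open>nat ^ 'n\<close>, so \<open>('n, 'k) mpolys\<close> is the polynomial ring
  over \<open>'k\<close> in variables indexed by the finite type \<open>'n\<close> (multiplication is convolution).\<close>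

type_synonym ('n, 'k) mpolys = "(nat, 'n) vec \<Rightarrow>\<^sub>0 'k"

abbreviation coef :: "('n::finite, 'k::field) mpolys \<Rightarrow> nat ^ 'n \<Rightarrow> 'k"
  where "coef \<equiv> Poly_Mapping.lookup"

abbreviation supp :: "('n::finite, 'k::field) mpolys \<Rightarrow> (nat ^ 'n) set"
  where "supp \<equiv> Poly_Mapping.keys"

abbreviation term_of :: "('n::finite, 'k::field) mpolys \<Rightarrow> nat ^ 'n \<Rightarrow> ('n, 'k) mpolys"
  where "term_of f m \<equiv> Poly_Mapping.single m (coef f m)"

abbreviation xpow :: "nat ^ 'n \<Rightarrow> ('n::finite, 'k::field) mpolys"
  where "xpow m \<equiv> Poly_Mapping.single m 1"

abbreviation ideal_gen :: "'a::comm_ring_1 set \<Rightarrow> 'a set"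
  where "ideal_gen \<equiv> module.span (*)"

definition monomial_ideal :: "('n::finite, 'k::field) mpolys set \<Rightarrow> bool"
  where "monomial_ideal M \<longleftrightarrow> (\<exists>A. M = ideal_gen (xpow ` A))"

text \<open>Exponents of the minimal monomial generators of a monomial ideal: the monomials of the ideal
  that are minimal with respect to divisibility.  The two lemmas below show that this is
  the least monomial generating set.\<close>

definition min_gens :: "('n::finite, 'k::field) mpolys set \<Rightarrow> (nat ^ 'n) set"
  where "min_gens M = {u. xpow u \<in> M \<and> (\<forall>m. xpow m \<in> M \<and> m \<le> u \<longrightarrow> m = u)}"

interpretation ideal_module: module "(*) :: 'a::comm_ring_1 \<Rightarrow> 'a \<Rightarrow> 'a"
  by standard (simp_all add: algebra_simps)

lemma xpow_in_ideal_gen_iff: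
  "(xpow u :: ('n::finite, 'k::field) mpolys) \<in> ideal_gen (xpow ` B) \<longleftrightarrow> (\<exists>b\<in>B. b \<le> u)"
proof
  have *: "\<forall>m\<in>supp f. \<exists>b\<in>B. b \<le> m"
    if "f \<in> ideal_gen (xpow ` B)" for f :: "('n, 'k) mpolys"
    using that
  proof (induction rule: ideal_module.span_induct_alt)
    case base
    then show ?case by simp
  next
    case (step c x y)
    then obtain b where b: "b \<in> B" "x = xpow b" by auto
    show ?case
    proof
      fix m assume "m \<in> supp (c * x + y)"
      then consider "m \<in> supp (c * x)" | "m \<in> supp y"
        using Poly_Mapping.keys_add[of "c * x" y] by blast
      then show "\<exists>b\<in>B. b \<le> m"
      proof cases
        case 1
        then obtain a where "m = a + b"
          using Poly_Mapping.keys_mult[of c x] b by auto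
        then have "b \<le> m" by (simp add: less_eq_vec_def)
        then show ?thesis using b by blast
      next
        case 2
        then show ?thesis using step by blast
      qed
    qed
  qed
  assume "(xpow u :: ('n, 'k) mpolys) \<in> ideal_gen (xpow ` B)"
  from *[OF this] show "\<exists>b\<in>B. b \<le> u" by simp
next
  assume "\<exists>b\<in>B. b \<le> u"
  then obtain b where b: "b \<in> B" "b \<le> u" by blast
  have "u = (\<chi> i. u $ i - b $ i) + b"
    using b by (simp add: vec_eq_iff less_eq_vec_def)
  then have "(xpow u :: ('n, 'k) mpolys) = xpow (\<chi> i. u $ i - b $ i) * xpow b"
    by (metis Poly_Mapping.mult_single mult_1)
  then show "(xpow u :: ('n, 'k) mpolys) \<in> ideal_gen (xpow ` B)"
    using b by (auto intro: ideal_module.span_scale ideal_module.span_base)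
qed

lemma min_gens_least:
  assumes "(M :: ('n::finite, 'k::field) mpolys set) = ideal_gen (xpow ` B)"
  shows "min_gens M \<subseteq> B"
proof
  fix u assume u: "u \<in> min_gens M"
  then obtain b where b: "b \<in> B" "b \<le> u"
    using xpow_in_ideal_gen_iff[of u B, where 'k = 'k] assms by (auto simp: min_gens_def)
  have "(xpow b :: ('n, 'k) mpolys) \<in> M"
    using b assms by (auto intro: ideal_module.span_base)
  then show "u \<in> B"
    using u b by (auto simp: min_gens_def)
qed

lemma min_gens_generate:
  assumes "monomial_ideal (M :: ('n::finite, 'k::field) mpolys set)"
  shows "ideal_gen (xpow ` min_gens M) = M"
proof -
  obtain A where A: "M = ideal_gen (xpow ` A)"
    using assms by (auto simp: monomial_ideal_def)
  have sub: "ideal_gen M = M"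
    unfolding A by (rule ideal_module.span_span)
  have below: "\<exists>m\<in>min_gens M. m \<le> u" if "xpow u \<in> M" for u
    using that
  proof (induction "\<Sum>i\<in>UNIV. u $ i" arbitrary: u rule: less_induct)
    case less
    show ?case
    proof (cases "u \<in> min_gens M")
      case True
      then show ?thesis by (auto simp: less_eq_vec_def)
    next
      case False
      then obtain m where m: "xpow m \<in> M" "m \<le> u" "m \<noteq> u"
        using less.prems by (auto simp: min_gens_def)
      then obtain i where "m $ i < u $ i"
        by (metis less_eq_vec_def order_le_less vec_eq_iff)
      then have "(\<Sum>i\<in>UNIV. m $ i) < (\<Sum>i\<in>UNIV. u $ i)"
        using m(2) by (intro sum_strict_mono_ex1) (auto simp: less_eq_vec_def)
      from less.hyps[OF this m(1)] show ?thesis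
        using m(2) by (meson less_eq_vec_def order_trans)
    qed
  qed
  show ?thesis
  proof
    have "xpow ` min_gens M \<subseteq> M" by (auto simp: min_gens_def)
    then show "ideal_gen (xpow ` min_gens M) \<subseteq> M"
      using ideal_module.span_mono sub by blast
    have "xpow ` A \<subseteq> (ideal_gen (xpow ` min_gens M) :: ('n, 'k) mpolys set)"
    proof
      fix f :: "('n, 'k) mpolys" assume "f \<in> xpow ` A"
      then obtain a where a: "a \<in> A" "f = xpow a" by blast
      then have "xpow a \<in> M" unfolding A by (auto intro: ideal_module.span_base)
      then show "f \<in> ideal_gen (xpow ` min_gens M)"
        using below a xpow_in_ideal_gen_iff by blast
    qed
    then show "M \<subseteq> ideal_gen (xpow ` min_gens M)"
      unfolding A by (metis ideal_module.span_mono ideal_module.span_span)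
  qed
qed


section \<open>Lattices, gradings and lattice ideals\<close>

text \<open>\<open>(*s)\<close> is the action of \<open>int\<close> on \<open>int ^ 'n\<close>, so \<open>span\<close> and \<open>independent\<close> are
  those of \<open>int\<close>-modules: \<open>L\<close> is a free subgroup with a basis of \<open>r\<close> elements.\<close>

definition sublattice_of_rank :: "(int ^ 'n::finite) set \<Rightarrow> nat \<Rightarrow> bool"
  where "sublattice_of_rank L r \<longleftrightarrow>
    (\<exists>B. finite B \<and> card B = r \<and> module.independent (*s) B \<and> module.span (*s) B = L)"

definition int_exp :: "nat ^ 'n \<Rightarrow> int ^ 'n::finite"
  where "int_exp m = (\<chi> i. int (m $ i))"

text \<open>The degree of \<open>xpow m\<close>, as the coset of \<open>m\<close> modulo \<open>L\<close>; the grading monoid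
  (the image of the nonnegative vectors in the quotient group) is \<open>range (deg L)\<close>.\<close>

definition deg :: "(int ^ 'n::finite) set \<Rightarrow> nat ^ 'n \<Rightarrow> (int ^ 'n) set"
  where "deg L m = (\<lambda>v. int_exp m + v) ` L"

definition graded_piece :: "(int ^ 'n::finite) set \<Rightarrow> (int ^ 'n) set \<Rightarrow> ('n, 'k::field) mpolys set"
  where "graded_piece L g = {f. \<forall>m\<in>supp f. deg L m = g}"

definition homogeneous_ideal :: "(int ^ 'n::finite) set \<Rightarrow> ('n, 'k::field) mpolys set \<Rightarrow> bool"
  where "homogeneous_ideal L I \<longleftrightarrow>
    (\<exists>H. H \<subseteq> (\<Union>g\<in>range (deg L). graded_piece L g) \<and> I = ideal_gen H)"

text \<open>For \<open>'k\<close>-subspaces \<open>U \<subseteq> V\<close>: the quotient \<open>V / U\<close> has dimension \<open>d\<close>, i.e. there are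
  \<open>d\<close> elements of \<open>V\<close> whose classes form a basis of \<open>V / U\<close>.\<close>

definition quotient_dim_eq ::
    "('n::finite, 'k::field) mpolys set \<Rightarrow> ('n, 'k) mpolys set \<Rightarrow> nat \<Rightarrow> bool"
  where "quotient_dim_eq V U d \<longleftrightarrow>
    (\<exists>B. B \<subseteq> V \<and> finite B \<and> card B = d \<and>
      (\<forall>c. (\<Sum>b\<in>B. Poly_Mapping.single 0 (c b) * b) \<in> U \<longrightarrow> (\<forall>b\<in>B. c b = 0)) \<and>
      (\<forall>f\<in>V. \<exists>c. f - (\<Sum>b\<in>B. Poly_Mapping.single 0 (c b) * b) \<in> U))"

definition L_graded :: "(int ^ 'n::finite) set \<Rightarrow> ('n, 'k::field) mpolys set \<Rightarrow> bool"
  where "L_graded L I \<longleftrightarrow> homogeneous_ideal L I \<and>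
    (\<forall>g\<in>range (deg L). quotient_dim_eq (graded_piece L g) (I \<inter> graded_piece L g) 1)"

definition pos_part :: "int ^ 'n::finite \<Rightarrow> nat ^ 'n"
  where "pos_part u = (\<chi> i. nat (u $ i))"

definition neg_part :: "int ^ 'n::finite \<Rightarrow> nat ^ 'n"
  where "neg_part u = (\<chi> i. nat (- u $ i))"

definition lattice_ideal :: "(int ^ 'n::finite) set \<Rightarrow> ('n, 'k::field) mpolys set"
  where "lattice_ideal L = ideal_gen {xpow (pos_part u) - xpow (neg_part u) | u. u \<in> L}"


section \<open>Initial ideals and coherence\<close>

definition weight :: "int ^ 'n::finite \<Rightarrow> nat ^ 'n \<Rightarrow> int"
  where "weight w m = (\<Sum>i\<in>UNIV. w $ i * int (m $ i))"

definition init_form :: "int ^ 'n::finite \<Rightarrow> ('n, 'k::field) mpolys \<Rightarrow> ('n, 'k) mpolys"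
  where "init_form w f =
    (\<Sum>m | m \<in> supp f \<and> (\<forall>m'\<in>supp f. weight w m' \<le> weight w m). term_of f m)"

definition init_ideal :: "int ^ 'n::finite \<Rightarrow> ('n, 'k::field) mpolys set \<Rightarrow> ('n, 'k) mpolys set"
  where "init_ideal w I = ideal_gen {init_form w f | f. f \<in> I \<and> f \<noteq> 0}"

text \<open>For weights \<open>w\<close> with negative entries, \<open>init_ideal w (lattice_ideal L)\<close> need not be
  \<open>L\<close>-graded when \<open>L\<close> contains nonzero nonnegative vectors, hence the second conjunct.\<close>

definition monomial_initial_ideal :: "(int ^ 'n::finite) set \<Rightarrow> ('n, 'k::field) mpolys set \<Rightarrow> bool"
  where "monomial_initial_ideal L M \<longleftrightarrow>
    monomial_ideal M \<and> L_graded L M \<and> (\<exists>w. M = init_ideal w (lattice_ideal L))"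

definition scale_vars :: "'k ^ 'n \<Rightarrow> ('n::finite, 'k::field) mpolys \<Rightarrow> ('n, 'k) mpolys"
  where "scale_vars lam f =
    (\<Sum>m\<in>supp f. Poly_Mapping.single m ((\<Prod>i\<in>UNIV. (lam $ i) ^ (m $ i)) * coef f m))"

definition coherent :: "(int ^ 'n::finite) set \<Rightarrow> ('n, 'k::field) mpolys set \<Rightarrow> bool"
  where "coherent L J \<longleftrightarrow> L_graded L J \<and>
    (\<exists>w lam. (\<forall>i. lam $ i \<noteq> 0) \<and> J = scale_vars lam ` init_ideal w (lattice_ideal L))"


section \<open>Term orders, flips and wall ideals\<close>

text \<open>A term order is given by its strict part: \<open>(a, b) \<in> r\<close> means that \<open>xpow a\<close> is
  smaller than \<open>xpow b\<close>.\<close>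

definition term_order :: "(nat ^ 'n::finite) rel \<Rightarrow> bool"
  where "term_order r \<longleftrightarrow> strict_linear_order r \<and>
    (\<forall>a b c. (a, b) \<in> r \<longrightarrow> (a + c, b + c) \<in> r) \<and> (\<forall>a. a \<noteq> 0 \<longrightarrow> (0, a) \<in> r)"

definition init_ideal_order ::
    "(nat ^ 'n::finite) rel \<Rightarrow> ('n, 'k::field) mpolys set \<Rightarrow> ('n, 'k) mpolys set"
  where "init_ideal_order r I = ideal_gen {term_of f m | f m.
    f \<in> I \<and> m \<in> supp f \<and> (\<forall>m'\<in>supp f. m' \<noteq> m \<longrightarrow> (m', m) \<in> r)}"

definition wall_ideal ::
    "('n::finite, 'k::field) mpolys set \<Rightarrow> nat ^ 'n \<Rightarrow> nat ^ 'n \<Rightarrow> ('n, 'k) mpolys set"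
  where "wall_ideal M u v = ideal_gen (insert (xpow u - xpow v) (xpow ` (min_gens M - {u})))"

definition flippable ::
    "('n::finite, 'k::field) mpolys set \<Rightarrow> nat ^ 'n \<Rightarrow> nat ^ 'n \<Rightarrow> bool"
  where "flippable M u v \<longleftrightarrow>
    (\<forall>r. term_order r \<and> (v, u) \<in> r \<longrightarrow> init_ideal_order r (wall_ideal M u v) = M)"

text \<open>\<open>M\<^sub>1\<close> and \<open>M\<^sub>2\<close> differ by the flip over \<open>xpow u - xpow v\<close>.  If \<open>M\<^sub>1\<close> is \<open>L\<close>-graded
  and monomial, then \<open>v\<close> is determined by \<open>u\<close>.\<close>

definition flip_over :: "(int ^ 'n::finite) set \<Rightarrow> nat ^ 'n \<Rightarrow> nat ^ 'n \<Rightarrow>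
    ('n, 'k::field) mpolys set \<Rightarrow> ('n, 'k) mpolys set \<Rightarrow> bool"
  where "flip_over L u v M\<^sub>1 M\<^sub>2 \<longleftrightarrow>
    monomial_ideal M\<^sub>1 \<and> L_graded L M\<^sub>1 \<and>
    u \<in> min_gens M\<^sub>1 \<and> xpow v \<notin> M\<^sub>1 \<and> deg L v = deg L u \<and>
    flippable M\<^sub>1 u v \<and>
    (\<exists>r. term_order r \<and> (u, v) \<in> r \<and> M\<^sub>2 = init_ideal_order r (wall_ideal M\<^sub>1 u v))"

end

theory Submission
  imports Defs
begin

text \<open>Put \<open>l = u - v\<close> and let \<open>w1\<close>, \<open>w2\<close> be weights defining \<open>I\<close> and \<open>J\<close>.  Every fibre of the
  grading is cut into rows by the direction \<open>l\<close>; since reduction modulo the binomial of the flip moves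
  along a row, the standard monomials of \<open>I\<close> and \<open>J\<close> in a fibre lie in the same row.  As the rank is
  two and \<open>l\<close> turns out to be primitive, a linear functional \<open>y\<close> vanishing on \<open>l\<close> numbers the rows.
  If the standard row is the lowest one in every fibre, then the initial ideal for \<open>y\<close> is the wall
  ideal, and if it is always the highest one, \<open>- y\<close> does the job; no rescaling of the variables is
  needed.  So the heart of the matter is that there cannot be one fibre with rows below and another
  with rows above the standard row.  From minimal such fibres one builds a monomial that
  is alone in its row, but whose standard row can be neither its own nor one above or below it.\<close>

(* Read from left to right this rule re-associates products, which makes algebra_simps loop. *)
declare ideal_module.scale_scale [simp del]

section \<open>Minimal points of lattice fibres\<close>

definition idot :: "int ^ 'n::finite \<Rightarrow> int ^ 'n \<Rightarrow> int"
  where "idot w f = (\<Sum>i\<in>UNIV. w $ i * f $ i)"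

lemma idot_simps [simp]:
  "idot w 0 = 0" "idot w (f + g) = idot w f + idot w g" "idot w (f - g) = idot w f - idot w g"
  "idot w (- f) = - idot w f" "idot w (c *s f) = c * idot w f" "idot (- w) f = - idot w f"
  by (simp_all add: idot_def sum.distrib sum_subtractf sum_negf distrib_left right_diff_distrib
      sum_distrib_left mult_ac)

text \<open>The strict inequality encodes that \<open>m\<close> is the only point of smallest
  \<open>w\<close>-weight in its fibre, as happens for the exponents of standard monomials. Integer
  vectors are used so that moves in \<open>L\<close> can be added freely.\<close>

definition fibre_min :: "(int ^ 'n::finite) set \<Rightarrow> int ^ 'n \<Rightarrow> int ^ 'n \<Rightarrow> bool"
  where "fibre_min L w m \<longleftrightarrow> 0 \<le> m \<and> (\<forall>f\<in>L. 0 \<le> m + f \<and> f \<noteq> 0 \<longrightarrow> 0 < idot w f)"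

text \<open>Every move possible from the smaller point is possible from \<open>m\<close> too; this
  is the closure of standard monomials under division.\<close>

lemma fibre_min_diff:
  assumes "fibre_min L w m" "0 \<le> e" "0 \<le> m - e"
  shows "fibre_min L w (m - e)"
proof -
  have "0 \<le> m + f" if "0 \<le> m - e + f" for f
    unfolding less_eq_vec_def
  proof
    fix i
    show "0 $ i \<le> (m + f) $ i"
      using that[unfolded less_eq_vec_def, rule_format, of i]
        assms(2)[unfolded less_eq_vec_def, rule_format, of i] by simp
  qed
  then show ?thesis using assms by (auto simp: fibre_min_def)
qed

locale int_lattice =
  fixes L :: "(int ^ 'n::finite) set"
  assumes zero_L: "0 \<in> L"
    and add_L: "f \<in> L \<Longrightarrow> g \<in> L \<Longrightarrow> f + g \<in> L"
    and scale_L: "f \<in> L \<Longrightarrow> c *s f \<in> L"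
begin

lemma minus_L: "f \<in> L \<Longrightarrow> - f \<in> L"
  using scale_L[of f "-1"] by (metis (no_types) vector_sneg_minus1)

lemma diff_L: "f \<in> L \<Longrightarrow> g \<in> L \<Longrightarrow> f - g \<in> L"
  using add_L[of f "- g"] minus_L by simp

lemma fibre_min_unique:
  assumes "fibre_min L w m" "fibre_min L w (m + f)" "f \<in> L"
  shows "f = 0"
proof (rule ccontr)
  assume "f \<noteq> 0"
  then have "0 < idot w f" using assms by (auto simp: fibre_min_def)
  moreover have "0 < idot w (- f)"
    using assms minus_L[of f] \<open>f \<noteq> 0\<close> unfolding fibre_min_def
    by (metis add.right_neutral add_diff_cancel_right' diff_conv_add_uminus neg_equal_0_iff_equal)
  ultimately show False by simp
qed

end

text \<open>The integer points \<open>x\<close> with \<open>fibre_min L w1 x\<close> and \<open>fibre_min L w2 x\<close> play the role of the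
  standard monomials of the two ideals of the flip.\<close>

locale flip_lattice = int_lattice L for L :: "(int ^ 'n::finite) set" +
  fixes w1 w2 y l :: "int ^ 'n"
  assumes l_L: "l \<in> L"
    and ex_min1: "0 \<le> m \<Longrightarrow> \<exists>f\<in>L. fibre_min L w1 (m + f)"
    and min1_min2: "fibre_min L w1 m \<Longrightarrow> \<exists>j\<ge>0. fibre_min L w2 (m + j *s l)"
    and w1_l: "0 < idot w1 l" and w2_l: "idot w2 l < 0"
    and l_pos: "\<exists>i. 0 < l $ i" and l_neg: "\<exists>i. l $ i < 0"
    and y_l: "idot y l = 0"
    and y_eq_0: "f \<in> L \<Longrightarrow> idot y f = 0 \<Longrightarrow> \<exists>c. f = c *s l"
begin

text \<open>A coordinate that \<open>m + f\<close> shares with one of the two minimal points can be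
  lowered in both. The outcome is an off-row point of a smaller fibre, and the coordinate sum of
  \<open>m + f\<close> drops, so the process ends with disjoint supports.\<close>

lemma reduced_off_row:
  assumes y: "y = z \<or> y = - z"
    and "fibre_min L w1 m" "f \<in> L" "0 \<le> m + f" "idot z f < 0"
  shows "\<exists>m f j. fibre_min L w1 m \<and> f \<in> L \<and> 0 \<le> m + f \<and> idot z f < 0 \<and> 0 \<le> j \<and>
    fibre_min L w2 (m + j *s l) \<and>
    (\<forall>i. 0 < m $ i \<or> 0 < (m + j *s l) $ i \<longrightarrow> (m + f) $ i = 0)"
  using assms(2-)
proof (induction "nat (\<Sum>i\<in>UNIV. (m + f) $ i)" arbitrary: m f rule: less_induct)
  case less
  obtain j where j: "0 \<le> j" "fibre_min L w2 (m + j *s l)"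
    using min1_min2 less.prems by blast
  have zl: "idot z l = 0" using y y_l by auto
  show ?case
  proof (cases "\<forall>i. 0 < m $ i \<or> 0 < (m + j *s l) $ i \<longrightarrow> (m + f) $ i = 0")
    case True
    then show ?thesis using less.prems j by blast
  next
    case False
    then obtain i where i: "0 < m $ i \<or> 0 < (m + j *s l) $ i" "(m + f) $ i \<noteq> 0" by blast
    define e :: "int ^ 'n" where "e = axis i 1"
    have e0: "0 \<le> e" by (simp add: e_def less_eq_vec_def axis_def)
    have sub: "0 \<le> x - e" if "0 \<le> x" "0 < x $ i" for x
      using that by (auto simp: e_def less_eq_vec_def axis_def)
    have a: "0 \<le> m + f" "0 < (m + f) $ i"
      using i(2) less.prems(3) by (auto simp: less_eq_vec_def order_less_le)
    have smaller: "nat (\<Sum>k\<in>UNIV. (m + f - e) $ k) < nat (\<Sum>k\<in>UNIV. (m + f) $ k)"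
    proof -
      have "(\<Sum>k\<in>UNIV. (m + f) $ k) = (\<Sum>k\<in>UNIV. (m + f - e) $ k) + 1"
        by (simp add: sum.distrib sum_subtractf e_def axis_def)
      moreover have "0 \<le> (\<Sum>k\<in>UNIV. (m + f - e) $ k)"
        using sub[OF a] by (intro sum_nonneg) (auto simp: less_eq_vec_def)
      ultimately show ?thesis by simp
    qed
    show ?thesis
    proof (cases "0 < m $ i")
      case True
      have "0 \<le> m" using less.prems(1) by (simp add: fibre_min_def)
      then have "fibre_min L w1 (m - e)"
        using fibre_min_diff[OF less.prems(1) e0] sub True by blast
      moreover have "m - e + f = m + f - e" by simp
      ultimately show ?thesis
        using less.hyps[of "m - e" f] smaller sub[OF a] less.prems by metis
    next
      case False
      then have pos: "0 < (m + j *s l) $ i" using i by blast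
      have "0 \<le> m + j *s l" using j by (simp add: fibre_min_def)
      then have n2: "fibre_min L w2 (m + j *s l - e)"
        using fibre_min_diff[OF j(2) e0] sub pos by blast
      \<comment> \<open>Here \<open>m - e\<close> has a negative coordinate, so the
        \<open>w1\<close>-minimal point of the smaller fibre has to be found anew. Uniqueness of the
        \<open>w2\<close>-minimal point puts it in the row of \<open>m - e\<close>, hence
        \<open>- p\<close> points as far below that row as \<open>f\<close> did.\<close>
      obtain p where p: "p \<in> L" "fibre_min L w1 (m + f - e + p)"
        using ex_min1[OF sub[OF a]] by blast
      obtain k where k: "0 \<le> k" "fibre_min L w2 (m + f - e + p + k *s l)"
        using min1_min2[OF p(2)] by blast
      have "f + p + k *s l - j *s l = 0"
      proof (rule fibre_min_unique[OF n2])
        have "m + j *s l - e + (f + p + k *s l - j *s l) = m + f - e + p + k *s l" by simp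
        then show "fibre_min L w2 (m + j *s l - e + (f + p + k *s l - j *s l))" using k by (simp only:)
        show "f + p + k *s l - j *s l \<in> L"
          using less.prems p l_L by (intro add_L diff_L scale_L)
      qed
      then have "idot z (f + p + k *s l - j *s l) = 0" by simp
      then have "idot z (- p) < 0" using less.prems(4) zl by simp
      moreover have "m + f - e + p + - p = m + f - e" by simp
      ultimately show ?thesis
        using less.hyps[of "m + f - e + p" "- p"] smaller sub[OF a] minus_L p by metis
    qed
  qed
qed

text \<open>The functional \<open>z\<close> is one of \<open>y\<close>, \<open>- y\<close>, with the sign chosen so that the weight in the
  segment from \<open>w1\<close> to \<open>w2\<close> that vanishes on \<open>l\<close> is a nonnegative multiple of \<open>z\<close>.\<close>

lemma not_on_both_sides:
  assumes yz: "y = z \<or> y = - z"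
    and K: "\<And>f. f \<in> L \<Longrightarrow> 0 < idot z f \<Longrightarrow> 0 \<le> - idot w2 l * idot w1 f + idot w1 l * idot w2 f"
    and below: "fibre_min L w1 m1" "f1 \<in> L" "0 \<le> m1 + f1" "idot z f1 < 0"
    and above: "fibre_min L w1 m2" "f2 \<in> L" "0 \<le> m2 + f2" "0 < idot z f2"
  shows False
proof -
  have zl: "idot z l = 0" using yz y_l by auto
  have z0: "\<exists>c. f = c *s l" if "f \<in> L" "idot z f = 0" for f
    using y_eq_0[of f] that yz by auto
  \<comment> \<open>Both coefficients in \<open>K\<close> are positive, so a move with
    \<open>z\<close> positive cannot lower \<open>w2\<close> without raising
    \<open>w1\<close>.\<close>
  have K': False if "f \<in> L" "0 < idot z f" "idot w1 f \<le> 0" "idot w2 f < 0" for f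
  proof -
    have "- idot w2 l * idot w1 f \<le> 0" "idot w1 l * idot w2 f < 0"
      using that w1_l w2_l by (simp_all add: mult_nonpos_nonpos mult_nonneg_nonpos mult_less_0_iff zero_le_mult_iff)
    then show False using K[OF that(1,2)] by linarith
  qed
  obtain m' h' j' where m': "fibre_min L w1 m'" "h' \<in> L" "0 \<le> m' + h'" "idot z h' < 0" "0 \<le> j'"
      "fibre_min L w2 (m' + j' *s l)"
      "\<And>i. 0 < m' $ i \<or> 0 < (m' + j' *s l) $ i \<Longrightarrow> (m' + h') $ i = 0"
    using reduced_off_row[OF yz below] by blast
  have yz': "y = - z \<or> y = - (- z)" using yz by auto
  obtain m h j where m: "fibre_min L w1 m" "h \<in> L" "0 \<le> m + h" "0 < idot z h" "0 \<le> j"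
      "fibre_min L w2 (m + j *s l)"
      "\<And>i. 0 < m $ i \<or> 0 < (m + j *s l) $ i \<Longrightarrow> (m + h) $ i = 0"
    using reduced_off_row[OF yz' above(1-3)] above(4) by auto
  have nonneg: "0 \<le> x $ i" if "fibre_min L w x" for x w i
    using that by (simp add: fibre_min_def less_eq_vec_def)
  have w1h': "0 < idot w1 h'"
    using m' unfolding fibre_min_def by (metis idot_simps(1) less_irrefl)
  have w2h': "0 < idot w2 (h' - j' *s l)"
  proof -
    have "h' - j' *s l \<noteq> 0"
    proof
      assume "h' - j' *s l = 0"
      then have "idot z (h' - j' *s l) = 0" by simp
      then show False using m'(4) zl by simp
    qed
    moreover have "m' + j' *s l + (h' - j' *s l) = m' + h'" by simp
    moreover have "h' - j' *s l \<in> L" using m' l_L by (intro diff_L scale_L)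
    ultimately show ?thesis using m'(3,6) unfolding fibre_min_def by metis
  qed
  \<comment> \<open>With \<open>j' = 0\<close> the move \<open>- h'\<close> would lower both weights
    while \<open>z\<close> increases, against \<open>K'\<close>.\<close>
  have j': "0 < j'"
  proof (rule ccontr)
    assume "\<not> 0 < j'"
    then have "j' = 0" using m' by simp
    then show False using K'[of "- h'"] w1h' w2h' m' minus_L by simp
  qed
  \<comment> \<open>The combination of \<open>f\<close> and \<open>h'\<close> killed by
    \<open>z\<close> is some \<open>c *s l\<close>, and \<open>w1\<close> forces \<open>c\<close> to
    be positive. Since \<open>h'\<close> is nonpositive where \<open>l\<close> is positive,
    \<open>f\<close> has to be positive there.\<close>
  have right: "0 < f $ i" if f: "f \<in> L" "0 < idot z f" "0 < idot w1 f" and i: "0 < l $ i" for f i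
  proof -
    have "0 < (m' + j' *s l) $ i" using nonneg[OF m'(1), of i] j' i by (simp add: add_nonneg_pos)
    then have h'i: "h' $ i \<le> 0" using m'(7)[of i] nonneg[OF m'(1), of i] by simp
    have "(- idot z h') *s f + idot z f *s h' \<in> L" using f m' by (intro add_L scale_L)
    then obtain c where c: "(- idot z h') *s f + idot z f *s h' = c *s l"
      using z0[of "(- idot z h') *s f + idot z f *s h'"] by auto
    have "idot w1 ((- idot z h') *s f + idot z f *s h') = c * idot w1 l" by (simp only: c idot_simps)
    moreover have "0 < - idot z h' * idot w1 f" "0 < idot z f * idot w1 h'"
      using f m' w1h' by (simp_all add: mult_neg_pos)
    ultimately have "0 < c * idot w1 l" unfolding idot_simps by linarith
    then have "0 < c" using w1_l by (simp add: zero_less_mult_iff)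
    have "((- idot z h') *s f + idot z f *s h') $ i = c * l $ i" by (simp add: c)
    then have "- idot z h' * f $ i = c * l $ i - idot z f * h' $ i" by (simp add: algebra_simps)
    moreover have "0 < c * l $ i" "idot z f * h' $ i \<le> 0"
      using \<open>0 < c\<close> i f h'i by (simp_all add: mult_nonneg_nonpos)
    ultimately have "0 < - idot z h' * f $ i" by linarith
    then show ?thesis using m'(4) by (simp add: mult_less_0_iff)
  qed
  \<comment> \<open>Mirror image of \<open>right\<close>: now \<open>h' - j' *s l\<close>, the move
    from the \<open>w2\<close>-minimal point to \<open>m' + h'\<close>, is nonpositive where
    \<open>l\<close> is negative, and \<open>w2\<close> forces \<open>c\<close> to be
    negative.\<close>
  have left: "0 < f $ i" if f: "f \<in> L" "0 < idot z f" "0 < idot w2 f" and i: "l $ i < 0" for f i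
  proof -
    have "j' * l $ i < 0" using j' i by (simp add: mult_less_0_iff)
    moreover have "0 \<le> m' $ i + j' * l $ i" using nonneg[OF m'(6), of i] by simp
    ultimately have h'i: "(h' - j' *s l) $ i \<le> 0" using m'(7)[of i] by simp
    have "(- idot z h') *s f + idot z f *s (h' - j' *s l) \<in> L"
      using f m' l_L by (intro add_L scale_L diff_L)
    then obtain c where c: "(- idot z h') *s f + idot z f *s (h' - j' *s l) = c *s l"
      using z0[of "(- idot z h') *s f + idot z f *s (h' - j' *s l)"] by (auto simp: zl)
    have "idot w2 ((- idot z h') *s f + idot z f *s (h' - j' *s l)) = c * idot w2 l"
      by (simp only: c idot_simps)
    moreover have "0 < - idot z h' * idot w2 f" "0 < idot z f * idot w2 (h' - j' *s l)"
      using f m' w2h' by (simp_all add: mult_neg_pos del: idot_simps)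
    ultimately have "0 < c * idot w2 l" unfolding idot_simps by linarith
    then have "c < 0" using w2_l by (simp add: zero_less_mult_iff)
    have "((- idot z h') *s f + idot z f *s (h' - j' *s l)) $ i = c * l $ i" by (simp add: c)
    then have "- idot z h' * f $ i = c * l $ i - idot z f * (h' - j' *s l) $ i"
      unfolding vector_add_component vector_smult_component by linarith
    moreover have "0 < c * l $ i" using \<open>c < 0\<close> i by (simp add: mult_neg_neg)
    moreover have "idot z f * (h' - j' *s l) $ i \<le> 0"
      using f h'i by (simp only: mult_nonneg_nonpos less_imp_le)
    ultimately have "0 < - idot z h' * f $ i" by linarith
    then show ?thesis using m'(4) by (simp add: mult_less_0_iff)
  qed
  obtain r where r: "0 < l $ r" using l_pos by blast
  obtain q where q: "l $ q < 0" using l_neg by blast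
  have w1h: "0 < idot w1 h"
    using m unfolding fibre_min_def by (metis idot_simps(1) less_irrefl)
  \<comment> \<open>Otherwise \<open>m + j *s l\<close> is positive at \<open>r\<close>, so
    \<open>m + h\<close> vanishes there and \<open>h\<close> is nonpositive at \<open>r\<close>,
    against \<open>right\<close>.\<close>
  have "j = 0"
  proof (rule ccontr)
    assume "j \<noteq> 0"
    then have "0 < (m + j *s l) $ r" using nonneg[OF m(1), of r] m(5) r by (simp add: add_nonneg_pos)
    then have "h $ r \<le> 0" using m(7)[of r] nonneg[OF m(1), of r] by simp
    then show False using right[OF m(2,4) w1h r] by simp
  qed
  then have min2: "fibre_min L w2 m" using m by simp
  have w2h: "0 < idot w2 h"
    using m min2 unfolding fibre_min_def by (metis idot_simps(1) less_irrefl)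
  \<comment> \<open>By \<open>left\<close> and \<open>right\<close>, \<open>h\<close> is positive
    wherever \<open>l\<close> is nonzero. So \<open>m + h\<close> is positive there, and
    disjointness of supports makes \<open>m\<close> vanish.\<close>
  have m_zero: "m $ i = 0" if "l $ i \<noteq> 0" for i
  proof -
    have "0 < h $ i"
      using left[OF m(2,4) w2h] right[OF m(2,4) w1h] that by (cases "0 < l $ i") auto
    then show ?thesis using m(7)[of i] nonneg[OF m(1), of i] by (cases "m $ i = 0") auto
  qed
  \<comment> \<open>Move \<open>h\<close> against \<open>l\<close> until \<open>w1\<close> stops being positive on it.  The monomial \<open>M\<close> is \<open>m\<close> enlarged
    just enough for \<open>M + g\<close> to be nonnegative: \<open>g\<close> shows that \<open>M\<close> is not standard, and \<open>M\<close> is too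
    small for \<open>M + l\<close> or \<open>M - l\<close> to be nonnegative.\<close>
  define k where "k = (LEAST k. idot w1 (h - int k *s l) \<le> 0)"
  \<comment> \<open>The integer \<open>idot w1 l\<close> is at least 1, so \<open>idot w1 h\<close>
    steps surely suffice.\<close>
  have "idot w1 (h - int (nat (idot w1 h)) *s l) \<le> 0"
    using w1h w1_l by simp
  then have k: "idot w1 (h - int k *s l) \<le> 0"
    unfolding k_def by (rule LeastI)
  then have "0 < k" using w1h by (cases k) auto
  then have k1: "0 < idot w1 (h - int (k - 1) *s l)"
    using not_less_Least[of "k - 1" "\<lambda>k. idot w1 (h - int k *s l) \<le> 0"] by (simp add: k_def)
  define g where "g = h - int k *s l"
  have gl: "g + l = h - int (k - 1) *s l"
    using \<open>0 < k\<close> by (simp add: g_def vec_eq_iff algebra_simps of_nat_diff)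
  have g: "g \<in> L" "0 < idot z g" "idot w1 g \<le> 0"
    using m k zl by (simp_all add: g_def diff_L scale_L l_L)
  \<comment> \<open>By minimality of \<open>k\<close>, the weight \<open>w1\<close> is still
    positive one step before \<open>g\<close>, so \<open>right\<close> applies to
    \<open>g + l\<close>.\<close>
  have gl_pos: "0 < g $ i + l $ i" if "0 < l $ i" for i
    using right[of "g + l" i] g(1,2) l_L zl that k1 add_L unfolding gl[symmetric] by simp
  define M where "M = (\<chi> i. if 0 < l $ i then max 0 (- g $ i) else m $ i)"
  have M0: "0 \<le> M" using nonneg[OF m(1)] by (simp add: M_def less_eq_vec_def)
  have Mg: "0 \<le> M + g"
    unfolding less_eq_vec_def
  proof
    fix i
    consider "0 < l $ i" | "l $ i \<le> 0" by linarith
    then show "0 $ i \<le> (M + g) $ i"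
    proof cases
      case 1
      then show ?thesis by (simp add: M_def)
    next
      case 2
      have "int k * l $ i \<le> 0" using 2 by (simp add: mult_nonneg_nonpos)
      moreover have "0 \<le> m $ i + h $ i" using m(3) by (simp add: less_eq_vec_def)
      ultimately show ?thesis using 2 by (simp add: M_def g_def)
    qed
  qed
  have Ml: "M $ i < l $ i" if "0 < l $ i" for i
    using gl_pos[OF that] that by (simp add: M_def)
  have Mq: "M $ q = 0" using m_zero[of q] q by (simp add: M_def)
  obtain e where e: "e \<in> L" "fibre_min L w1 (M + e)" using ex_min1[OF M0] by blast
  obtain j2 where j2: "0 \<le> j2" "fibre_min L w2 (M + e + j2 *s l)" using min1_min2[OF e(2)] by blast
  \<comment> \<open>Within the row of \<open>M\<close>, adding a positive multiple of
    \<open>l\<close> fails at \<open>q\<close> and a negative one at \<open>r\<close>. So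
    \<open>M\<close> itself would be \<open>w1\<close>-minimal, although \<open>w1\<close> does not
    increase along \<open>g\<close>.\<close>
  have ze: "idot z e \<noteq> 0"
  proof
    assume "idot z e = 0"
    then obtain c where c: "e = c *s l" using z0 e by blast
    have "\<not> 0 < c"
    proof
      assume "0 < c"
      then have "c * l $ q < 0" using q by (rule mult_pos_neg)
      then show False using nonneg[OF e(2), of q] Mq by (simp add: c)
    qed
    moreover have "\<not> c < 0"
    proof
      assume "c < 0"
      then have "c * l $ r \<le> - l $ r" 
        using r mult_right_mono[of c "-1" "l $ r"] by simp
      then show False using nonneg[OF e(2), of r] Ml[OF r] by (simp add: c)
    qed
    ultimately have "e = 0" using c by (cases "c = 0") auto
    then have "0 < idot w1 g"
      using e(2) Mg g(1,2) unfolding fibre_min_def by (metis add.right_neutral idot_simps(1) less_irrefl)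
    then show False using g by simp
  qed
  \<comment> \<open>The move from \<open>M\<close> to the \<open>w2\<close>-minimal point of its
    fibre; it ends in the same row as \<open>M + e\<close>.\<close>
  define f where "f = e + j2 *s l"
  have f: "f \<in> L" "idot z f = idot z e" "fibre_min L w2 (M + f)"
    using e zl j2 by (simp_all add: f_def add.assoc add_L scale_L l_L)
  have w2f: "idot w2 f < 0"
  proof -
    have "- f \<noteq> 0" using ze f(2) by auto
    moreover have "0 \<le> M + f + - f" using M0 by simp
    ultimately have "0 < idot w2 (- f)" using f(3) minus_L[OF f(1)] unfolding fibre_min_def by blast
    then show ?thesis by simp
  qed
  show False
  proof (cases "idot z f < 0")
    case True
    then have "0 < (- f) $ q" using left[of "- f" q] w2f q minus_L[OF f(1)] by simp
    then show False using nonneg[OF f(3), of q] Mq by simp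
  next
    case False
    then have zf: "0 < idot z f" using ze f by simp
    \<comment> \<open>Either \<open>f\<close> is a legal move from \<open>m\<close> as well,
      contradicting the \<open>w2\<close>-minimality of \<open>m\<close>, or \<open>f\<close> is
      negative where \<open>l\<close> is positive. In the latter case \<open>right\<close> makes
      \<open>w1\<close> nonpositive on \<open>f\<close>, and \<open>K'\<close> applies.\<close>
    show False
    proof (cases "\<forall>i. 0 < l $ i \<longrightarrow> 0 \<le> f $ i")
      case True
      have "0 \<le> m + f"
        unfolding less_eq_vec_def
      proof
        fix i show "0 $ i \<le> (m + f) $ i"
          using True nonneg[OF m(1), of i] nonneg[OF f(3), of i]
          by (cases "0 < l $ i") (auto simp: M_def)
      qed
      then have "0 < idot w2 f" using min2 f(1) zf unfolding fibre_min_def by (metis idot_simps(1) less_irrefl)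
      then show False using w2f by simp
    next
      case False
      then have "idot w1 f \<le> 0" using right[OF f(1) zf] by (meson linorder_not_le less_le_not_le)
      then show False using K'[OF f(1) zf _ w2f] by blast
    qed
  qed
qed

text \<open>On \<open>L\<close> the combination \<open>W\<close> of the two weights vanishes on
  \<open>l\<close> and is therefore proportional to \<open>y\<close>. Its sign on an upward move
  decides whether \<open>z\<close> is \<open>y\<close> or \<open>- y\<close>; for \<open>- y\<close>
  the two offending points exchange roles.\<close>

lemma rows_one_sided:
  "(\<forall>m f. fibre_min L w1 m \<longrightarrow> f \<in> L \<longrightarrow> 0 \<le> m + f \<longrightarrow> 0 \<le> idot y f) \<or>
   (\<forall>m f. fibre_min L w1 m \<longrightarrow> f \<in> L \<longrightarrow> 0 \<le> m + f \<longrightarrow> idot y f \<le> 0)"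
proof (rule ccontr)
  assume "\<not> ?thesis"
  then obtain m1 f1 m2 f2 where below: "fibre_min L w1 m1" "f1 \<in> L" "0 \<le> m1 + f1" "idot y f1 < 0"
    and above: "fibre_min L w1 m2" "f2 \<in> L" "0 \<le> m2 + f2" "0 < idot y f2"
    by (metis linorder_not_le)
  define W where "W = (\<lambda>f. - idot w2 l * idot w1 f + idot w1 l * idot w2 f)"
  have parallel: "idot y g * W f = idot y f * W g" if "f \<in> L" "g \<in> L" for f g
  proof -
    have "idot y g *s f - idot y f *s g \<in> L" using that by (intro diff_L scale_L)
    then obtain c where c: "idot y g *s f - idot y f *s g = c *s l" 
      using y_eq_0[of "idot y g *s f - idot y f *s g"] by auto
    have "W (idot y g *s f - idot y f *s g) = 0" unfolding c by (simp add: W_def)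
    moreover have "W (p *s f - q *s g) = p * W f - q * W g" for p q
      unfolding W_def idot_simps by algebra
    ultimately show ?thesis by simp
  qed
  show False
  proof (cases "0 \<le> W f2")
    case True
    have "0 \<le> W f" if "f \<in> L" "0 < idot y f" for f
    proof -
      have "0 \<le> idot y f2 * W f" using parallel[OF that(1) above(2)] that True by simp
      then show ?thesis using above(4) by (simp add: zero_le_mult_iff)
    qed
    then show False using not_on_both_sides[of y] below above unfolding W_def by blast
  next
    case False
    have "0 \<le> W f" if "f \<in> L" "0 < idot (- y) f" for f
    proof -
      have "0 < idot y f2 * W f"
        using parallel[OF that(1) above(2)] that False by (simp add: zero_less_mult_iff)
      then show ?thesis using above(4) by (simp add: zero_less_mult_iff)
    qed
    then show False
      using not_on_both_sides[of "- y" m2 f2 m1 f1] below above unfolding W_def by simp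
  qed
qed

end

section \<open>Standard monomials of initial ideals of the lattice ideal\<close>

lemma int_exp_nth [simp]: "int_exp m $ i = int (m $ i)"
  by (simp add: int_exp_def)

lemma int_exp_add [simp]: "int_exp (a + b) = int_exp a + int_exp b"
  by (simp add: vec_eq_iff)

lemma int_exp_nonneg [simp]: "0 \<le> int_exp m"
  by (simp add: less_eq_vec_def)

lemma int_exp_inject [simp]: "int_exp a = int_exp b \<longleftrightarrow> a = b"
  by (simp add: vec_eq_iff)

lemma int_exp_pos_part: "0 \<le> x \<Longrightarrow> int_exp (pos_part x) = x"
  by (simp add: vec_eq_iff pos_part_def less_eq_vec_def)

lemma weight_eq_idot: "weight w m = idot w (int_exp m)"
  by (simp add: weight_def idot_def)

lemma exponent_le_obtains:
  fixes a b :: "nat ^ 'n::finite"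
  assumes "a \<le> b"
  obtains c where "b = c + a"
proof
  show "b = (\<chi> i. b $ i - a $ i) + a" using assms by (simp add: vec_eq_iff less_eq_vec_def)
qed

section \<open>Terms, monomials and membership in ideals\<close>

lemma sum_terms: "(\<Sum>m\<in>supp f. term_of f m) = f"
proof (rule poly_mapping_eqI)
  fix k
  show "coef (\<Sum>m\<in>supp f. term_of f m) k = coef f k"
    by (simp add: lookup_sum lookup_single when_def in_keys_iff)
qed

lemma single_eq_scale: "Poly_Mapping.single m c = Poly_Mapping.single 0 c * xpow m"
  by (simp add: mult_single)

lemma ideal_gen_subset: "S \<subseteq> ideal_gen T \<Longrightarrow> ideal_gen S \<subseteq> ideal_gen T"
  using ideal_module.span_mono[of S "ideal_gen T"] by (simp only: ideal_module.span_span)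

lemma single_in_ideal_gen:
  "xpow m \<in> ideal_gen S \<Longrightarrow> Poly_Mapping.single m c \<in> ideal_gen S"
  by (subst single_eq_scale) (rule ideal_module.span_scale)

lemma xpow_in_ideal_gen:
  assumes "Poly_Mapping.single m c \<in> ideal_gen S" "c \<noteq> 0"
  shows "xpow m \<in> ideal_gen S"
proof -
  have "Poly_Mapping.single 0 (inverse c) * Poly_Mapping.single m c \<in> ideal_gen S"
    using assms by (intro ideal_module.span_scale)
  then show ?thesis using assms by (simp add: mult_single)
qed

lemma xpow_add_in_ideal_gen:
  "xpow m \<in> ideal_gen S \<Longrightarrow> xpow (c + m) \<in> ideal_gen S"
  using ideal_module.span_scale[of "xpow m" S "xpow c"] by (simp add: mult_single)

lemma monomial_ideal_ideal_gen: "monomial_ideal M \<Longrightarrow> ideal_gen M = M"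
  unfolding monomial_ideal_def using ideal_module.span_span by blast

lemma monomial_ideal_xpow_le:
  assumes "monomial_ideal M" "xpow a \<in> M" "a \<le> b"
  shows "xpow b \<in> M"
proof -
  obtain c where "b = c + a" using assms(3) by (rule exponent_le_obtains)
  then show ?thesis
    using xpow_add_in_ideal_gen[of a M c] assms monomial_ideal_ideal_gen by metis
qed

lemma monomial_ideal_supp:
  assumes "monomial_ideal M" "f \<in> M" "m \<in> supp f"
  shows "xpow m \<in> M"
proof -
  obtain A where A: "M = ideal_gen (xpow ` A)" using assms by (auto simp: monomial_ideal_def)
  have "f \<in> ideal_gen (xpow ` A)" using A assms by simp
  then have "\<forall>m\<in>supp f. xpow m \<in> M"
  proof (induction rule: ideal_module.span_induct_alt)
    case base
    then show ?case by simp
  next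
    case (step c x y)
    then obtain a where a: "a \<in> A" "x = xpow a" by auto
    show ?case
    proof
      fix m assume "m \<in> supp (c * x + y)"
      then consider "m \<in> supp (c * x)" | "m \<in> supp y"
        using Poly_Mapping.keys_add[of "c * x" y] by blast
      then show "xpow m \<in> M"
      proof cases
        case 1
        then obtain b where "m = b + a" using Poly_Mapping.keys_mult[of c x] a by auto
        moreover have "xpow a \<in> ideal_gen (xpow ` A)"
          using a by (auto intro: ideal_module.span_base)
        ultimately show ?thesis using A xpow_add_in_ideal_gen by blast
      next
        case 2
        then show ?thesis using step by blast
      qed
    qed
  qed
  then show ?thesis using assms by blast
qed

lemma monomial_ideal_min_gen_below:
  fixes M :: "('n::finite, 'k::field) mpolys set"
  assumes "monomial_ideal M" "xpow m \<in> M"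
  obtains a where "a \<in> min_gens M" "a \<le> m"
  using assms xpow_in_ideal_gen_iff[of m "min_gens M", where 'k = 'k] min_gens_generate[of M]
  by auto

section \<open>Initial forms of binomials\<close>

lemma init_form_binomial:
  fixes a b :: "nat ^ 'n::finite"
  assumes "weight w b < weight w a"
  shows "init_form w (xpow a - xpow b :: ('n, 'k::field) mpolys) = xpow a"
proof -
  let ?f = "xpow a - xpow b :: ('n, 'k) mpolys"
  have ab: "a \<noteq> b" using assms by auto
  have supp: "supp ?f = {a, b}"
    using ab by (auto simp: in_keys_iff lookup_minus lookup_single when_def split: if_splits)
  have "{m. m \<in> supp ?f \<and> (\<forall>m'\<in>supp ?f. weight w m' \<le> weight w m)} = {a}"
    using assms by (auto simp: supp)
  then show ?thesis
    unfolding init_form_def using ab by (simp add: lookup_minus lookup_single)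
qed

lemma init_form_binomial_homogeneous:
  fixes a b :: "nat ^ 'n::finite"
  assumes "weight w b = weight w a"
  shows "init_form w (xpow a - xpow b :: ('n, 'k::field) mpolys) = xpow a - xpow b"
proof -
  let ?f = "xpow a - xpow b :: ('n, 'k) mpolys"
  have "supp ?f \<subseteq> {a, b}"
    by (auto simp: in_keys_iff lookup_minus lookup_single when_def split: if_splits)
  then have "weight w m = weight w a" if "m \<in> supp ?f" for m
    using assms that by auto
  then have "{m. m \<in> supp ?f \<and> (\<forall>m'\<in>supp ?f. weight w m' \<le> weight w m)} = supp ?f"
    by auto
  then show ?thesis
    unfolding init_form_def by (simp add: sum_terms)
qed

lemma init_form_in_init_ideal:
  "f \<in> I \<Longrightarrow> f \<noteq> 0 \<Longrightarrow> init_form w f \<in> init_ideal w I"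
  unfolding init_ideal_def by (auto intro!: ideal_module.span_base)

lemma xpow_diff_eq_0_iff: "(xpow a - xpow b :: ('n::finite, 'a::field) mpolys) = 0 \<longleftrightarrow> a = b"
proof
  assume "(xpow a - xpow b :: ('n, 'a) mpolys) = 0"
  then have "coef (xpow a :: ('n, 'a) mpolys) a = coef (xpow b) a" by simp
  then show "a = b" by (simp add: lookup_single when_def split: if_splits)
qed simp

section \<open>Degrees, the lattice ideal and \<open>L\<close>-graded monomial ideals\<close>

context int_lattice
begin

lemma deg_eq_iff: "deg L a = deg L b \<longleftrightarrow> int_exp a - int_exp b \<in> L"
proof
  assume "deg L a = deg L b"
  moreover have "int_exp a + 0 \<in> deg L a" unfolding deg_def using zero_L by blast
  ultimately obtain f where "int_exp a + 0 = int_exp b + f" "f \<in> L" unfolding deg_def by blast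
  then show "int_exp a - int_exp b \<in> L" by simp
next
  have sub: "deg L a \<subseteq> deg L b" if "int_exp a - int_exp b \<in> L" for a b
  proof
    fix x assume "x \<in> deg L a"
    then obtain f where "x = int_exp a + f" "f \<in> L" by (auto simp: deg_def)
    then have "x = int_exp b + (int_exp a - int_exp b + f)" "int_exp a - int_exp b + f \<in> L"
      using that add_L by auto
    then show "x \<in> deg L b" unfolding deg_def by blast
  qed
  assume *: "int_exp a - int_exp b \<in> L"
  then have "int_exp b - int_exp a \<in> L" using minus_L by fastforce
  then show "deg L a = deg L b" using sub * by blast
qed

lemma deg_add: "deg L a = deg L b \<Longrightarrow> deg L (c + a) = deg L (c + b)"
  by (simp add: deg_eq_iff)

text \<open>Splitting off the greatest common divisor of the two monomials leaves the generator
  given by their exponent difference.\<close>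

lemma binomial_in_lattice_ideal:
  assumes "deg L a = deg L b"
  shows "(xpow a - xpow b :: ('n, 'k::field) mpolys) \<in> lattice_ideal L"
proof -
  define d where "d = int_exp a - int_exp b"
  define c :: "nat ^ 'n" where "c = (\<chi> i. min (a $ i) (b $ i))"
  have "a = c + pos_part d" "b = c + neg_part d"
    by (auto simp: vec_eq_iff c_def d_def pos_part_def neg_part_def)
  then have "(xpow a - xpow b :: ('n, 'k) mpolys) = xpow c * (xpow (pos_part d) - xpow (neg_part d))"
    by (simp add: right_diff_distrib mult_single)
  moreover have "d \<in> L" using assms by (simp add: d_def deg_eq_iff)
  then have "(xpow (pos_part d) - xpow (neg_part d) :: ('n, 'k) mpolys) \<in> lattice_ideal L"
    unfolding lattice_ideal_def by (intro ideal_module.span_base) blast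
  ultimately show ?thesis
    unfolding lattice_ideal_def by (simp only: ideal_module.span_scale)
qed

text \<open>Adding up the coefficients of one degree is additive, and it kills every multiple of a
  generator because the two monomials of a shifted binomial have the same degree.\<close>

lemma lattice_ideal_fibre_sum:
  assumes "f \<in> lattice_ideal L"
  shows "(\<Sum>m | m \<in> supp f \<and> deg L m = g. coef f m) = 0"
proof -
  define \<phi> where "\<phi> f = (\<Sum>m\<in>supp f. if deg L m = g then coef f m else 0)"
    for f :: "('n, 'a::field) mpolys"
  have add: "\<phi> (p + q) = \<phi> p + \<phi> q" for p q
    unfolding \<phi>_def
    by (rule setsum_keys_plus_distrib[where f = "\<lambda>m c. if deg L m = g then c else 0"]) auto
  have phi_sum: "\<phi> (\<Sum>x\<in>A. h x) = (\<Sum>x\<in>A. \<phi> (h x))" if "finite A" for A :: "(nat ^ 'n) set" and h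
    using that by (induction A rule: finite_induct) (simp_all add: add, simp add: \<phi>_def)
  have single: "\<phi> (Poly_Mapping.single m c) = (if deg L m = g then c else 0)" for m c
    by (simp add: \<phi>_def)
  have binomial: "\<phi> (p * (xpow a - xpow b)) = 0" if "deg L a = deg L b" for p a b
  proof -
    have "p * (xpow a - xpow b) = (\<Sum>m\<in>supp p. term_of p m) * (xpow a - xpow b)"
      by (simp only: sum_terms)
    also have "\<dots> = (\<Sum>m\<in>supp p. Poly_Mapping.single (m + a) (coef p m) +
        Poly_Mapping.single (m + b) (- coef p m))"
      by (simp add: sum_distrib_right right_diff_distrib mult_single single_uminus sum_subtractf)
    also have "\<phi> \<dots> = 0"
      using deg_add[OF that] by (auto simp: phi_sum add single intro!: sum.neutral)
    finally show ?thesis .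
  qed
  have "\<phi> f = 0"
    using assms unfolding lattice_ideal_def
  proof (induction rule: ideal_module.span_induct_alt)
    case base
    then show ?case by (simp add: \<phi>_def)
  next
    case (step c x y)
    then obtain d where d: "d \<in> L" "x = xpow (pos_part d) - xpow (neg_part d)" by blast
    have "int_exp (pos_part d) - int_exp (neg_part d) = d"
      by (simp add: vec_eq_iff pos_part_def neg_part_def)
    then have "deg L (pos_part d) = deg L (neg_part d)" using d by (simp add: deg_eq_iff)
    then show ?case using step d binomial by (simp add: add)
  qed
  then show ?thesis by (simp add: \<phi>_def sum.inter_filter)
qed

text \<open>If \<open>M\<close> contained all monomials of the element spanning the one-dimensional
  quotient, it would contain that element.\<close>

lemma ex_standard:
  assumes "monomial_ideal M" "L_graded L M"
  obtains s where "deg L s = deg L m" "xpow s \<notin> M"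
proof -
  obtain B where B: "B \<subseteq> graded_piece L (deg L m)" "card B = 1"
    "\<And>c. (\<Sum>b\<in>B. Poly_Mapping.single 0 (c b) * b) \<in> M \<inter> graded_piece L (deg L m) \<Longrightarrow> \<forall>b\<in>B. c b = 0"
    using assms(2) unfolding L_graded_def quotient_dim_eq_def by blast
  obtain b where b: "B = {b}" using B(2) card_1_singletonE by blast
  have "b \<notin> M"
  proof
    assume "b \<in> M"
    then have "b \<in> M \<inter> graded_piece L (deg L m)" using B(1) b by blast
    then show False using B(3)[of "\<lambda>_. 1"] b by simp
  qed
  have "\<exists>s\<in>supp b. xpow s \<notin> M"
  proof (rule ccontr)
    assume "\<not> ?thesis"
    then have "\<forall>s\<in>supp b. term_of b s \<in> ideal_gen M"
      using single_in_ideal_gen[of _ M] monomial_ideal_ideal_gen[OF assms(1)] by metis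
    then have "(\<Sum>s\<in>supp b. term_of b s) \<in> ideal_gen M"
      by (intro ideal_module.span_sum) blast
    then show False using \<open>b \<notin> M\<close> monomial_ideal_ideal_gen[OF assms(1)] by (simp add: sum_terms)
  qed
  then show thesis using that B(1) b by (auto simp: graded_piece_def)
qed

lemma standard_unique:
  assumes "monomial_ideal M" "L_graded L M"
    and "deg L a = deg L b" "xpow a \<notin> M" "xpow b \<notin> M"
  shows "a = b"
proof (rule ccontr)
  assume "a \<noteq> b"
  have "quotient_dim_eq (graded_piece L (deg L a)) (M \<inter> graded_piece L (deg L a)) 1"
    using assms(2) by (auto simp: L_graded_def)
  then obtain B where B: "card B = 1"
    "\<forall>f\<in>graded_piece L (deg L a).
      \<exists>c. f - (\<Sum>b\<in>B. Poly_Mapping.single 0 (c b) * b) \<in> M \<inter> graded_piece L (deg L a)"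
    unfolding quotient_dim_eq_def by blast
  obtain x where x: "B = {x}" using B(1) card_1_singletonE by blast
  have "xpow a \<in> graded_piece L (deg L a)" "xpow b \<in> graded_piece L (deg L a)"
    using assms(3) by (auto simp: graded_piece_def)
  then obtain c d where c: "xpow a - Poly_Mapping.single 0 c * x \<in> M"
    and d: "xpow b - Poly_Mapping.single 0 d * x \<in> M"
    using B(2) x by fastforce
  \<comment> \<open>The combination of the two relations that eliminates \<open>x\<close>. If
    \<open>d\<close> is nonzero, \<open>h\<close> puts \<open>xpow a\<close> into \<open>M\<close>;
    if \<open>d = 0\<close>, the second relation puts \<open>xpow b\<close> there.\<close>
  define h where "h = Poly_Mapping.single a d - Poly_Mapping.single b c"
  have "h = Poly_Mapping.single 0 d * (xpow a - Poly_Mapping.single 0 c * x)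
      - Poly_Mapping.single 0 c * (xpow b - Poly_Mapping.single 0 d * x)"
    by (simp add: h_def right_diff_distrib mult_single mult.assoc[symmetric] mult.commute[of c d])
  also have "\<dots> \<in> ideal_gen M"
    using c d by (intro ideal_module.span_diff ideal_module.span_scale ideal_module.span_base)
  finally have "h \<in> ideal_gen M" .
  then have h: "h \<in> M" using monomial_ideal_ideal_gen assms(1) by blast
  have "d = 0"
  proof (rule ccontr)
    assume "d \<noteq> 0"
    then have "a \<in> supp h" using \<open>a \<noteq> b\<close> by (simp add: h_def in_keys_iff lookup_minus lookup_single)
    then show False using monomial_ideal_supp assms h by blast
  qed
  then show False using d assms(5) by simp
qed

text \<open>As a monomial ideal contains the monomials of its elements, the initial form of
  \<open>xpow s - xpow a\<close> must not involve a standard \<open>s\<close>, so \<open>a\<close>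
  is strictly heavier. Conversely, the fibre has a standard monomial and minimal points are
  unique.\<close>

lemma standard_iff_fibre_min:
  assumes "monomial_ideal M" "L_graded L M" "M = init_ideal w (lattice_ideal L)"
  shows "xpow m \<notin> M \<longleftrightarrow> fibre_min L w (int_exp m)"
proof -
  have min: "fibre_min L w (int_exp s)" if s: "xpow s \<notin> M" for s
    unfolding fibre_min_def
  proof (intro conjI ballI impI)
    fix f assume f: "f \<in> L" "0 \<le> int_exp s + f \<and> f \<noteq> 0"
    define a where "a = pos_part (int_exp s + f)"
    have a: "int_exp a = int_exp s + f" using f by (simp add: a_def int_exp_pos_part)
    then have "a \<noteq> s" using f by auto
    have "deg L a = deg L s" using a f by (simp add: deg_eq_iff)
    then have sa: "xpow s - xpow a \<in> lattice_ideal L" by (simp add: binomial_in_lattice_ideal)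
    have init: "init_form w (xpow s - xpow a) \<in> M"
      using init_form_in_init_ideal[OF sa, of w] \<open>a \<noteq> s\<close> assms(3)
      by (metis xpow_diff_eq_0_iff)
    show "0 < idot w f"
    proof (rule ccontr)
      assume "\<not> 0 < idot w f"
      then have "weight w a \<le> weight w s" by (simp add: weight_eq_idot a)
      then have "s \<in> supp (init_form w (xpow s - xpow a :: ('n, 'a) mpolys))"
        using \<open>a \<noteq> s\<close>
        by (cases "weight w a = weight w s")
          (simp_all add: init_form_binomial init_form_binomial_homogeneous in_keys_iff
            lookup_minus lookup_single)
      then show False using monomial_ideal_supp[OF assms(1) init] s by blast
    qed
  qed simp
  show ?thesis
  proof
    assume "fibre_min L w (int_exp m)"
    obtain s where s: "deg L s = deg L m" "xpow s \<notin> M" using ex_standard assms(1,2) by blast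
    then have "fibre_min L w (int_exp m + (int_exp s - int_exp m))" using min by simp
    then have "int_exp s - int_exp m = 0"
      using fibre_min_unique \<open>fibre_min L w (int_exp m)\<close> s(1) deg_eq_iff by blast
    then show "xpow m \<notin> M" using s by simp
  qed (rule min)
qed

end

section \<open>Lattices of rank two\<close>

interpretation int_vec: module "(*s) :: int \<Rightarrow> int ^ 'n \<Rightarrow> int ^ 'n"
  by standard (simp_all add: vec_eq_iff algebra_simps)

lemma rank_two_basis:
  fixes L :: "(int ^ 'n::finite) set"
  assumes "sublattice_of_rank L 2"
  obtains b c where "L = {p *s b + q *s c | p q. True}"
    and "\<And>p q. p *s b + q *s c = 0 \<Longrightarrow> p = 0 \<and> q = 0"
proof -
  obtain B where B: "card B = 2" "int_vec.independent B" "int_vec.span B = L"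
    using assms unfolding sublattice_of_rank_def by blast
  obtain b c where bc: "B = {b, c}" "b \<noteq> c" using B(1) card_2_iff by metis
  have "x \<in> L \<longleftrightarrow> (\<exists>p q. x = p *s b + q *s c)" for x
  proof -
    have "x \<in> L \<longleftrightarrow> (\<exists>p q. x - p *s b = q *s c)"
      unfolding B(3)[symmetric] bc int_vec.span_insert int_vec.span_singleton by auto
    then show ?thesis by (simp add: algebra_simps)
  qed
  then have "L = {p *s b + q *s c | p q. True}" by blast
  moreover have "p = 0 \<and> q = 0" if "p *s b + q *s c = 0" for p q
  proof (rule ccontr)
    assume "\<not> ?thesis"
    moreover have "(\<Sum>x\<in>B. (if x = b then p else q) *s x) = 0"
      using that bc by auto
    moreover have "finite B" using bc by simp
    ultimately have "int_vec.dependent B"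
      unfolding int_vec.dependent_explicit using bc
      by (intro exI[of _ B] exI[of _ "\<lambda>x. if x = b then p else q"]) auto
    then show False using B(2) by blast
  qed
  ultimately show thesis using that by blast
qed

lemma sublattice_int_lattice:
  assumes "sublattice_of_rank L r"
  shows "int_lattice L"
proof -
  obtain B where "int_vec.span B = L"
    using assms unfolding sublattice_of_rank_def by blast
  then show ?thesis
    using int_vec.span_zero int_vec.span_add int_vec.span_scale by unfold_locales blast+
qed

text \<open>After cancelling the gcd of \<open>p\<close> and \<open>q\<close>, a Bezout identity
  writes \<open>l\<close> as \<open>p'\<close> times a lattice vector, so primitivity makes
  \<open>p'\<close> a unit.\<close>

lemma primitive_multiple:
  fixes f l :: "int ^ 'n::finite"
  assumes "int_lattice L" and L: "f \<in> L" "l \<in> L" and pq: "p *s f = q *s l" "p \<noteq> 0"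
    and primitive: "\<And>c l'. l' \<in> L \<Longrightarrow> l = c *s l' \<Longrightarrow> \<bar>c\<bar> = 1"
  shows "\<exists>c. f = c *s l"
proof -
  interpret int_lattice L by fact
  define g where "g = gcd p q"
  have "g \<noteq> 0" using pq by (simp add: g_def)
  obtain p' q' where p': "p = g * p'" "q = g * q'" "coprime p' q'"
    using gcd_coprime_exists[of p q] \<open>g \<noteq> 0\<close> unfolding g_def by (metis mult.commute)
  have eq: "p' *s f = q' *s l"
    using pq(1) \<open>g \<noteq> 0\<close> by (simp add: vec_eq_iff p' mult.assoc)
  obtain x y where xy: "x * p' + y * q' = 1"
    using p'(3) bezout_int[of p' q'] by auto
  have "l = p' *s (x *s l + y *s f)"
  proof -
    have "l = (x * p' + y * q') *s l" by (simp add: xy)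
    also have "\<dots> = p' *s (x *s l) + y *s (q' *s l)" by (simp add: vec_eq_iff algebra_simps)
    also have "\<dots> = p' *s (x *s l + y *s f)" by (simp add: eq[symmetric] vec_eq_iff algebra_simps)
    finally show ?thesis .
  qed
  moreover have "x *s l + y *s f \<in> L" using L by (intro add_L scale_L)
  ultimately have "\<bar>p'\<bar> = 1" using primitive by blast
  then have "p' * p' = 1" by (metis abs_mult_self_eq mult_1)
  then have "f = (p' * q') *s l"
    using eq by (metis int_vec.scale_scale int_vec.scale_one)
  then show ?thesis by blast
qed

lemma rank_two_functional:
  fixes L :: "(int ^ 'n::finite) set"
  assumes "sublattice_of_rank L 2" "l \<in> L" "l \<noteq> 0"
    and primitive: "\<And>c l'. l' \<in> L \<Longrightarrow> l = c *s l' \<Longrightarrow> \<bar>c\<bar> = 1"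
  obtains y where "idot y l = 0" "\<And>f. f \<in> L \<Longrightarrow> idot y f = 0 \<Longrightarrow> \<exists>c. f = c *s l"
proof -
  obtain b c where L: "L = {p *s b + q *s c | p q. True}"
    and indep: "\<And>p q. p *s b + q *s c = 0 \<Longrightarrow> p = 0 \<and> q = 0"
    using rank_two_basis assms(1) by blast
  have "\<exists>i k. b $ i * c $ k \<noteq> b $ k * c $ i"
  proof (rule ccontr)
    assume "\<not> ?thesis"
    then have "c $ k *s b + (- b $ k) *s c = 0" for k
      by (simp add: vec_eq_iff algebra_simps)
    then have "b $ k = 0" for k using indep[of "c $ k" "- b $ k"] by simp
    then have "b = 0" by (simp add: vec_eq_iff)
    then show False using indep[of 1 0] by simp
  qed
  then obtain i k where ik: "b $ i * c $ k - b $ k * c $ i \<noteq> 0" by auto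
  \<comment> \<open>So \<open>idot y f\<close> is the determinant of \<open>l\<close> and
    \<open>f\<close> in the coordinates \<open>i\<close> and \<open>k\<close>, where the basis has a
    nonzero minor.\<close>
  define y :: "int ^ 'n" where "y = axis k (l $ i) - axis i (l $ k)"
  have y: "idot y f = l $ i * f $ k - l $ k * f $ i" for f
    by (simp add: y_def idot_def left_diff_distrib sum_subtractf axis_def if_distrib[of "\<lambda>x. x * _"] cong: if_cong)
  show thesis
  proof
    show "idot y l = 0" by (simp add: y)
    fix f assume f: "f \<in> L" "idot y f = 0"
    obtain p q where pq: "f = p *s b + q *s c" using f L by blast
    obtain m n where mn: "l = m *s b + n *s c" using assms(2) L by blast
    \<comment> \<open>Multiplicativity of the determinant: the minor of the basis splits off and can
      be cancelled.\<close>
    have "(m * q - n * p) * (b $ i * c $ k - b $ k * c $ i) = 0"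
      using f(2) unfolding y pq mn by (simp add: algebra_simps)
    then have det: "m * q = n * p" using ik by simp
    have "m *s f = p *s l" "n *s f = q *s l"
      using det unfolding pq mn
      by (simp_all add: vec_eq_iff algebra_simps)
    moreover have "m \<noteq> 0 \<or> n \<noteq> 0"
    proof (rule ccontr)
      assume "\<not> ?thesis"
      then have "l = 0" unfolding mn by simp
      then show False using assms(3) by contradiction
    qed
    ultimately obtain p' q' where "p' *s f = q' *s l" "p' \<noteq> 0" by metis
    then show "\<exists>c. f = c *s l"
      by (rule primitive_multiple[OF sublattice_int_lattice[OF assms(1)] f(1) assms(2)])
        (rule primitive)
  qed
qed

section \<open>The wall ideal of a flip\<close>

locale wall = int_lattice L for L :: "(int ^ 'n::finite) set" +
  fixes I J :: "('n, 'k::field) mpolys set" and u v :: "nat ^ 'n" and w1 w2 :: "int ^ 'n"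
    and r :: "(nat ^ 'n) rel"
  assumes I: "monomial_ideal I" "L_graded L I" "I = init_ideal w1 (lattice_ideal L)"
    and J: "monomial_ideal J" "L_graded L J" "J = init_ideal w2 (lattice_ideal L)"
    and u: "u \<in> min_gens I" and v: "xpow v \<notin> I" and deg_v: "deg L v = deg L u"
    and vr: "(u, v) \<in> r" and J_wall: "J = init_ideal_order r (wall_ideal I u v)"
begin

abbreviation "W \<equiv> wall_ideal I u v"

definition "l = int_exp u - int_exp v"

lemma l_nth: "l $ i = int (u $ i) - int (v $ i)"
  by (simp add: l_def)

lemma l_L: "l \<in> L"
  using deg_v by (simp add: l_def deg_eq_iff[symmetric])

lemma u_I: "xpow u \<in> I"
  using u by (simp add: min_gens_def)

lemma u_neq_v: "u \<noteq> v"
  using u_I v by blast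

lemma l_neq_0: "l \<noteq> 0"
  using u_neq_v by (simp add: l_def)

lemma std1_iff: "xpow m \<notin> I \<longleftrightarrow> fibre_min L w1 (int_exp m)"
  using standard_iff_fibre_min I by blast

lemma std2_iff: "xpow m \<notin> J \<longleftrightarrow> fibre_min L w2 (int_exp m)"
  using standard_iff_fibre_min J by blast

section \<open>Membership in the wall ideal\<close>

lemma W_add: "f \<in> W \<Longrightarrow> g \<in> W \<Longrightarrow> f + g \<in> W"
  unfolding wall_ideal_def by (rule ideal_module.span_add)

lemma W_diff: "f \<in> W \<Longrightarrow> g \<in> W \<Longrightarrow> f - g \<in> W"
  unfolding wall_ideal_def by (rule ideal_module.span_diff)

lemma W_mult: "f \<in> W \<Longrightarrow> g * f \<in> W"
  unfolding wall_ideal_def by (rule ideal_module.span_scale)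

lemma W_sum: "(\<And>x. x \<in> A \<Longrightarrow> f x \<in> W) \<Longrightarrow> sum f A \<in> W"
  unfolding wall_ideal_def by (rule ideal_module.span_sum)

lemma W_single: "xpow m \<in> W \<Longrightarrow> Poly_Mapping.single m c \<in> W"
  unfolding wall_ideal_def by (rule single_in_ideal_gen)

lemma W_gen:
  assumes "a \<in> min_gens I" "a \<noteq> u" "a \<le> m"
  shows "xpow m \<in> W"
proof -
  obtain c where c: "m = c + a" using assms(3) by (rule exponent_le_obtains)
  show ?thesis
    unfolding wall_ideal_def c
    by (rule xpow_add_in_ideal_gen, rule ideal_module.span_base) (use assms in blast)
qed

lemma W_binomial: "xpow u - xpow v \<in> W"
  unfolding wall_ideal_def by (auto intro: ideal_module.span_base)

lemma W_binomial_shift: "xpow (c + u) - xpow (c + v) \<in> W"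
  using W_mult[OF W_binomial, of "xpow c"] by (simp add: right_diff_distrib mult_single)

text \<open>A monomial is its own leading term for every order.\<close>

lemma W_xpow_J: "xpow m \<in> W \<Longrightarrow> xpow m \<in> J"
  unfolding J_wall init_ideal_order_def
  by (rule ideal_module.span_base, rule CollectI, rule exI[of _ "xpow m"], rule exI[of _ m]) simp

lemma v_J: "xpow v \<in> J"
proof -
  let ?f = "xpow u - xpow v :: ('n, 'k) mpolys"
  have "supp ?f = {u, v}"
    using u_neq_v by (auto simp: in_keys_iff lookup_minus lookup_single when_def split: if_splits)
  then have "term_of ?f v \<in> J"
    unfolding J_wall init_ideal_order_def using vr W_binomial
    by (intro ideal_module.span_base) (auto intro!: exI[of _ ?f] exI[of _ v])
  moreover have "coef ?f v \<noteq> 0" using u_neq_v by (simp add: lookup_minus lookup_single)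
  ultimately show ?thesis
    unfolding J_wall init_ideal_order_def using xpow_in_ideal_gen by blast
qed

section \<open>The flip direction and reduction along rows\<close>

lemma w1_l: "0 < idot w1 l"
  using v l_L l_neq_0 unfolding std1_iff fibre_min_def by (auto simp: l_def)

lemma l_pos: "\<exists>i. 0 < l $ i"
proof (rule ccontr)
  assume "\<not> ?thesis"
  then have "u $ i \<le> v $ i" for i using l_nth[of i] by (metis not_less diff_gt_0_iff_gt of_nat_less_iff)
  then show False using monomial_ideal_xpow_le I(1) u_I v by (metis less_eq_vec_def)
qed

text \<open>Replace a factor \<open>xpow u\<close> by \<open>xpow v\<close> as long as possible,
  \<open>k\<close> times in all. Each replacement lowers the exponent of a variable with
  \<open>v $ i < u $ i\<close>; the end is a standard monomial of \<open>I\<close> or a multiple of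
  another minimal generator.\<close>

lemma in_W_or_reduces:
  "xpow m \<in> W \<or>
    (\<exists>k s. xpow s \<notin> I \<and> int_exp m = int_exp s + int k *s l \<and> xpow m - xpow s \<in> W)"
proof -
  obtain i where i: "v $ i < u $ i" using l_pos l_nth by auto
  show ?thesis
  proof (induction "m $ i" arbitrary: m rule: less_induct)
    case less
    show ?case
    proof (cases "xpow m \<in> I")
      case False
      then show ?thesis
        using W_diff[OF W_binomial W_binomial] by (intro disjI2 exI[of _ 0] exI[of _ m]) simp
    next
      case True
      then obtain a where a: "a \<in> min_gens I" "a \<le> m"
        using monomial_ideal_min_gen_below I(1) by blast
      show ?thesis
      proof (cases "a = u")
        case False
        then show ?thesis using W_gen a by blast
      next
        case True
        then obtain c where c: "m = c + u" using a exponent_le_obtains by blast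
        have "(c + v) $ i < m $ i" using i by (simp add: c)
        from less[OF this] show ?thesis
        proof (elim disjE exE conjE)
          assume "xpow (c + v) \<in> W"
          then show ?thesis using W_add[OF W_binomial_shift[of c]] by (fastforce simp: c)
        next
          fix k s
          assume s: "xpow s \<notin> I" "int_exp (c + v) = int_exp s + int k *s l" "xpow (c + v) - xpow s \<in> W"
          have "int_exp m = int_exp s + int (Suc k) *s l"
            using s(2) by (simp add: c l_def vec_eq_iff algebra_simps)
          moreover have "xpow m - xpow s \<in> W"
            using W_add[OF W_binomial_shift[of c] s(3)] by (simp add: c)
          ultimately show ?thesis using s(1) by blast
        qed
      qed
    qed
  qed
qed

text \<open>The standard monomial of \<open>J\<close> in the fibre cannot lie in \<open>W\<close>,
  so it reduces along its row to the standard monomial of \<open>I\<close>.\<close>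

lemma std1_std2:
  assumes "fibre_min L w1 x"
  shows "\<exists>j\<ge>0. fibre_min L w2 (x + j *s l)"
proof -
  define s where "s = pos_part x"
  have x: "int_exp s = x" using assms by (simp add: s_def fibre_min_def int_exp_pos_part)
  then have s: "xpow s \<notin> I" using assms std1_iff by simp
  obtain t where t: "deg L t = deg L s" "xpow t \<notin> J" using ex_standard J(1,2) by blast
  then obtain k s' where k: "xpow s' \<notin> I" "int_exp t = int_exp s' + int k *s l"
    using in_W_or_reduces[of t] W_xpow_J by blast
  have "deg L t = deg L s'" using k l_L by (simp add: deg_eq_iff scale_L)
  then have "s' = s" using standard_unique I(1,2) k s t by metis
  then show ?thesis using k t(2) x std2_iff by (intro exI[of _ "int k"]) simp
qed

text \<open>In the fibre of \<open>v\<close> the ideal \<open>J\<close> has its standard monomial at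
  \<open>v + j *s l\<close> with \<open>j\<close> positive, since \<open>xpow v\<close> lies in
  \<open>J\<close>; so \<open>v\<close> is heavier for \<open>w2\<close>.\<close>

lemma w2_l: "idot w2 l < 0"
proof -
  have "fibre_min L w1 (int_exp v)" using v std1_iff by blast
  then obtain j where j: "0 \<le> j" "fibre_min L w2 (int_exp v + j *s l)" using std1_std2 by blast
  have "j \<noteq> 0"
  proof
    assume "j = 0"
    then have "fibre_min L w2 (int_exp v)" using j(2) by simp
    then show False using v_J std2_iff by blast
  qed
  have "- (j *s l) \<noteq> 0"
    using \<open>j \<noteq> 0\<close> l_neq_0 by simp
  moreover have "- (j *s l) \<in> L" using l_L by (intro minus_L scale_L)
  moreover have "0 \<le> int_exp v + j *s l + - (j *s l)" by simp
  ultimately have "0 < idot w2 (- (j *s l))" using j(2) unfolding fibre_min_def by blast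
  then have "j * idot w2 l < 0" by simp
  then show ?thesis using j(1) by (simp add: mult_less_0_iff)
qed

lemma zero_std2: "xpow 0 \<notin> J"
proof
  assume "xpow 0 \<in> J"
  moreover have "0 \<le> m" for m :: "nat ^ 'n" by (simp add: less_eq_vec_def)
  ultimately have "xpow m \<in> J" for m using monomial_ideal_xpow_le J(1) by blast
  then show False using ex_standard[OF J(1,2)] by metis
qed

text \<open>Otherwise \<open>l\<close> would be a legal move from the exponent 0, which is standard
  for \<open>J\<close>, although \<open>w2\<close> decreases along \<open>l\<close>.\<close>

lemma l_neg: "\<exists>i. l $ i < 0"
proof (rule ccontr)
  assume "\<not> ?thesis"
  then have "0 \<le> int_exp 0 + l" by (simp add: less_eq_vec_def not_less)
  then have "0 < idot w2 l"
    using zero_std2 l_L l_neq_0 unfolding std2_iff fibre_min_def by blast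
  then show False using w2_l by simp
qed

text \<open>Dividing both by a common variable gives two monomials of equal degree outside
  \<open>I\<close>, one by minimality of \<open>a\<close> and one because divisors of standard
  monomials are standard. They coincide, and so would \<open>a\<close> and \<open>s\<close>.\<close>

lemma min_gen_disjoint:
  assumes "a \<in> min_gens I" "deg L s = deg L a" "xpow s \<notin> I"
  shows "a $ i = 0 \<or> s $ i = 0"
proof (rule ccontr)
  assume ai: "\<not> (a $ i = 0 \<or> s $ i = 0)"
  define e :: "nat ^ 'n" where "e = axis i 1"
  have "e \<le> a" "e \<le> s"
    using ai by (auto simp: e_def axis_def less_eq_vec_def)
  then obtain a' s' where a': "a = a' + e" and s': "s = s' + e"
    using exponent_le_obtains by metis
  have "a' \<le> a" "a' \<noteq> a" by (auto simp: a' e_def axis_def less_eq_vec_def vec_eq_iff)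
  then have "xpow a' \<notin> I" using assms(1) by (auto simp: min_gens_def)
  moreover have "s' \<le> s" by (simp add: s' less_eq_vec_def)
  then have "xpow s' \<notin> I" using monomial_ideal_xpow_le I(1) assms(3) by blast
  moreover have "deg L a' = deg L s'" using assms(2) unfolding deg_eq_iff a' s' by (metis int_exp_add add_diff_cancel_right minus_L minus_diff_eq)
  ultimately have "a' = s'" using standard_unique I(1,2) by blast
  then show False using assms a' s' by (auto simp: min_gens_def)
qed

text \<open>If \<open>l\<close> is a positive multiple of \<open>l'\<close>, the positive part of
  \<open>l'\<close> is not standard for \<open>I\<close> and divides \<open>xpow u\<close>.
  Minimality of \<open>u\<close> makes it equal to \<open>u\<close>, which leaves no room for a
  factor above 1.\<close>

lemma l_primitive:
  assumes "l' \<in> L" "l = c *s l'"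
  shows "\<bar>c\<bar> = 1"
proof -
  have pos: "c = 1" if c: "0 < c" and l': "l' \<in> L" "l = c *s l'" for c l'
  proof -
    have "0 < c * idot w1 l'" using w1_l l' by simp
    then have w: "0 < idot w1 l'" using c by (simp add: zero_less_mult_iff)
    define p where "p = pos_part l'"
    have p: "int (p $ i) = max 0 (l' $ i)" for i by (simp add: p_def pos_part_def)
    have "xpow p \<in> I"
    proof (rule ccontr)
      assume "xpow p \<notin> I"
      moreover have "- l' \<noteq> 0" using w by auto
      moreover have "0 \<le> int_exp p + - l'" by (simp add: less_eq_vec_def p)
      ultimately have "0 < idot w1 (- l')"
        using minus_L l' unfolding std1_iff fibre_min_def by blast
      then show False using w by simp
    qed
    moreover have "p \<le> u"
      unfolding less_eq_vec_def
    proof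
      fix i
      have "l' $ i \<le> int (u $ i)"
      proof (cases "0 < l' $ i")
        case True
        then have "1 * l' $ i \<le> c * l' $ i" using c by (intro mult_right_mono) auto
        then show ?thesis using l' l_nth[of i] by simp
      qed simp
      then show "p $ i \<le> u $ i" using p[of i] by simp
    qed
    ultimately have "p = u" using u by (auto simp: min_gens_def)
    obtain i where i: "0 < l $ i" using l_pos by blast
    then have "0 < l' $ i" using l' c by (simp add: zero_less_mult_iff)
    have "c * l' $ i \<le> 1 * l' $ i"
      using p[of i] \<open>p = u\<close> l_nth[of i] l' \<open>0 < l' $ i\<close> by simp
    then have "c \<le> 1" using \<open>0 < l' $ i\<close> by (simp add: mult_le_cancel_right)
    then show "c = 1" using c by simp
  qed
  have "c \<noteq> 0" using assms l_neq_0 by auto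
  moreover have "l = (- c) *s (- l')" using assms by (simp add: vec_eq_iff)
  ultimately show ?thesis
    using pos[of c l'] pos[of "- c" "- l'"] assms minus_L by (cases "0 < c") auto
qed

text \<open>Since \<open>u\<close> and \<open>v\<close> have disjoint supports, \<open>l\<close>
  agrees with \<open>u\<close> on the support of \<open>u\<close>. A point at least one copy of
  \<open>l\<close> beyond a nonnegative point is thus divisible by \<open>xpow u\<close>, and
  replacing \<open>u\<close> by \<open>v\<close> goes one step back.\<close>

lemma row_binomial_in_W:
  assumes "int_exp m = int_exp s + int k *s l"
  shows "xpow m - xpow s \<in> W"
  using assms
proof (induction k arbitrary: m)
  case 0
  then show ?case using W_diff[OF W_binomial W_binomial] by simp
next
  case (Suc k)
  have "u \<le> m"
    unfolding less_eq_vec_def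
  proof
    fix i
    have m: "int (m $ i) = int (s $ i) + int (Suc k) * l $ i"
      using arg_cong[OF Suc.prems, of "\<lambda>x. x $ i"] by simp
    show "u $ i \<le> m $ i"
    proof (cases "u $ i = 0")
      case False
      then have "l $ i = int (u $ i)" using min_gen_disjoint[OF u deg_v v, of i] l_nth[of i] by simp
      then show ?thesis using m by (simp add: algebra_simps flip: of_nat_mult of_nat_add)
    qed simp
  qed
  then obtain c where c: "m = c + u" by (rule exponent_le_obtains)
  have "int_exp (c + v) = int_exp s + int k *s l"
    using Suc.prems by (simp add: c l_def vec_eq_iff algebra_simps)
  then have "xpow (c + v) - xpow s \<in> W" by (rule Suc.IH)
  then show ?case using W_add[OF W_binomial_shift[of c], of "xpow (c + v) - xpow s"] by (simp add: c)
qed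

text \<open>Moving along the row would carry membership in \<open>W\<close> over to the standard
  monomial of \<open>J\<close>, and monomials of \<open>W\<close> lie in \<open>J\<close>.\<close>

lemma std_notin_W: "xpow s \<notin> I \<Longrightarrow> xpow s \<notin> W"
proof
  assume s: "xpow s \<notin> I" "xpow s \<in> W"
  obtain j where j: "0 \<le> j" "fibre_min L w2 (int_exp s + j *s l)"
    using std1_std2 s(1) std1_iff by blast
  define t where "t = pos_part (int_exp s + j *s l)"
  have t: "int_exp t = int_exp s + j *s l"
    using j by (simp add: t_def fibre_min_def int_exp_pos_part)
  then have "xpow t - xpow s \<in> W" using row_binomial_in_W[of t s "nat j"] j by simp
  then have "xpow t \<in> W" using W_add[OF _ s(2)] by fastforce
  then show False using W_xpow_J j t std2_iff by metis
qed

section \<open>Standard monomials modulo the wall ideal\<close>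

definition std :: "nat ^ 'n \<Rightarrow> nat ^ 'n"
  where "std m = (SOME s. deg L s = deg L m \<and> xpow s \<notin> I)"

lemma std: "deg L (std m) = deg L m" "xpow (std m) \<notin> I"
proof -
  have "\<exists>s. deg L s = deg L m \<and> xpow s \<notin> I" using ex_standard I(1,2) by metis
  then have "deg L (std m) = deg L m \<and> xpow (std m) \<notin> I" unfolding std_def by (rule someI_ex)
  then show "deg L (std m) = deg L m" "xpow (std m) \<notin> I" by auto
qed

lemma std_eqI: "deg L s = deg L m \<Longrightarrow> xpow s \<notin> I \<Longrightarrow> std m = s"
  using standard_unique I(1,2) std by metis

lemma reduces_to_std: "xpow m \<in> W \<or> xpow m - xpow (std m) \<in> W"
proof (rule disjCI)
  assume "xpow m - xpow (std m) \<notin> W"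
  moreover have "std m = s" if "xpow s \<notin> I" "int_exp m = int_exp s + int k *s l" for s k
    using that l_L by (intro std_eqI) (simp_all add: deg_eq_iff scale_L minus_L)
  ultimately show "xpow m \<in> W" using in_W_or_reduces[of m] by blast
qed

text \<open>In each degree the standard monomial of \<open>I\<close> is a basis modulo
  \<open>W\<close>: every monomial is congruent to it or to zero, and it does not lie in
  \<open>W\<close>.\<close>

lemma L_graded_W: "L_graded L W"
  unfolding L_graded_def
proof (intro conjI ballI)
  let ?H = "insert (xpow u - xpow v) (xpow ` (min_gens I - {u})) :: ('n, 'k) mpolys set"
  have "supp (xpow u - xpow v :: ('n, 'k) mpolys) \<subseteq> {u, v}"
    by (auto simp: in_keys_iff lookup_minus lookup_single when_def split: if_splits)
  then have "deg L m = deg L u" if "m \<in> supp (xpow u - xpow v :: ('n, 'k) mpolys)" for m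
    using that deg_v by (metis insertE singletonD subsetD)
  then have "(xpow u - xpow v :: ('n, 'k) mpolys) \<in> graded_piece L (deg L u)"
    unfolding graded_piece_def by blast
  moreover have "(xpow a :: ('n, 'k) mpolys) \<in> graded_piece L (deg L a)" for a by (simp add: graded_piece_def)
  ultimately have "?H \<subseteq> (\<Union>g\<in>range (deg L). graded_piece L g)" by blast
  then show "homogeneous_ideal L W"
    unfolding homogeneous_ideal_def wall_ideal_def by blast
next
  fix g assume "g \<in> range (deg L)"
  then obtain m0 where g: "g = deg L m0" by blast
  define s where "s = std m0"
  have "std m = s" if "deg L m = g" for m
    using that std g by (intro std_eqI) (simp_all add: s_def)
  then have red: "xpow m \<in> W \<or> xpow m - xpow s \<in> W" if "deg L m = g" for m
    using reduces_to_std[of m] that by simp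
  have piece: "p - q \<in> graded_piece L g" if "p \<in> graded_piece L g" "q \<in> graded_piece L g"
    for p q :: "('n, 'k) mpolys"
    using that by (auto simp: graded_piece_def in_keys_iff lookup_minus)
  have s_piece: "Poly_Mapping.single s c \<in> graded_piece L g" for c :: 'k
    using std[of m0] g by (simp add: graded_piece_def s_def)
  show "quotient_dim_eq (graded_piece L g) (W \<inter> graded_piece L g) 1"
    unfolding quotient_dim_eq_def
  proof (intro exI[of _ "{xpow s}"] conjI allI ballI impI)
    show "{xpow s} \<subseteq> (graded_piece L g :: ('n, 'k) mpolys set)" using s_piece[of 1] by blast
    show "finite {xpow s :: ('n, 'k) mpolys}" by simp
    show "card {xpow s :: ('n, 'k) mpolys} = 1" by simp
  next
    fix c :: "('n, 'k) mpolys \<Rightarrow> 'k" and b :: "('n, 'k) mpolys"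
    assume "(\<Sum>b\<in>{xpow s}. Poly_Mapping.single 0 (c b) * b) \<in> W \<inter> graded_piece L g"
      and b: "b \<in> {xpow s}"
    then have "Poly_Mapping.single s (c b) \<in> W" by (simp add: mult_single)
    then show "c b = 0"
      using xpow_in_ideal_gen[of s "c b"] std_notin_W std(2) unfolding wall_ideal_def s_def by blast
  next
    fix f :: "('n, 'k) mpolys" assume f: "f \<in> graded_piece L g"
    define c where "c m = (if xpow m \<in> W then 0 else coef f m)" for m
    have "term_of f m - Poly_Mapping.single s (c m) \<in> W" if "m \<in> supp f" for m
    proof (cases "xpow m \<in> W")
      case True
      then show ?thesis by (simp add: c_def W_single)
    next
      case False
      then have "xpow m - xpow s \<in> W" using red that f by (auto simp: graded_piece_def)
      from W_mult[OF this, of "Poly_Mapping.single 0 (coef f m)"] show ?thesis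
        using False by (simp add: c_def right_diff_distrib mult_single)
    qed
    then have "(\<Sum>m\<in>supp f. term_of f m - Poly_Mapping.single s (c m)) \<in> W" by (rule W_sum)
    moreover have "(\<Sum>m\<in>A. Poly_Mapping.single s (c m)) = Poly_Mapping.single s (\<Sum>m\<in>A. c m)"
      if "finite A" for A using that by (induction A rule: finite_induct) (simp_all add: single_add)
    ultimately have "f - Poly_Mapping.single s (\<Sum>m\<in>supp f. c m) \<in> W"
      by (simp add: sum_subtractf sum_terms)
    moreover have "f - Poly_Mapping.single s (\<Sum>m\<in>supp f. c m) \<in> graded_piece L g"
      using piece f s_piece by blast
    ultimately show "\<exists>c. f - (\<Sum>b\<in>{xpow s}. Poly_Mapping.single 0 (c b) * b) \<in> W \<inter> graded_piece L g"
      by (intro exI[of _ "\<lambda>_. \<Sum>m\<in>supp f. c m"]) (simp add: mult_single)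
  qed
qed

text \<open>By \<open>y_nonneg\<close>, the weight \<open>y\<close> is smallest on the standard row
  of each fibre. Monomials off that row lie in \<open>W\<close>, while those in it are congruent to
  the standard monomial; this describes initial forms modulo \<open>W\<close>.\<close>

lemma init_ideal_eq_W:
  assumes y_l: "idot y l = 0"
    and y_eq_0: "\<And>f. f \<in> L \<Longrightarrow> idot y f = 0 \<Longrightarrow> \<exists>c. f = c *s l"
    and y_nonneg: "\<And>m f. fibre_min L w1 m \<Longrightarrow> f \<in> L \<Longrightarrow> 0 \<le> m + f \<Longrightarrow> 0 \<le> idot y f"
  shows "init_ideal y (lattice_ideal L) = W"
proof
  have diff_L: "int_exp m - int_exp (std m) \<in> L" for m
    using std[of m] by (simp flip: deg_eq_iff)
  have min: "weight y (std m) \<le> weight y m" for m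
  proof -
    have "0 \<le> idot y (int_exp m - int_exp (std m))"
      using y_nonneg[of "int_exp (std m)" "int_exp m - int_exp (std m)"] std(2)[of m] diff_L[of m]
      unfolding std1_iff by simp
    then show ?thesis by (simp add: weight_eq_idot)
  qed
  have same_row: "\<exists>k. int_exp m = int_exp (std m) + int k *s l" if "weight y m = weight y (std m)" for m
  proof -
    have "idot y (int_exp m - int_exp (std m)) = 0" using that by (simp add: weight_eq_idot)
    then obtain c where c: "int_exp m - int_exp (std m) = c *s l" using y_eq_0 diff_L by blast
    have "0 \<le> c"
    proof (cases "c = 0")
      case False
      then have "int_exp m - int_exp (std m) \<noteq> 0" using c l_neq_0 by (auto simp: vec_eq_iff)
      moreover have "0 \<le> int_exp (std m) + (int_exp m - int_exp (std m))" by simp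
      ultimately have "0 < idot w1 (int_exp m - int_exp (std m))"
        using std(2)[of m] diff_L unfolding std1_iff fibre_min_def by blast
      then have "0 < c * idot w1 l" unfolding c by simp
      then show ?thesis using w1_l by (simp add: zero_less_mult_iff)
    qed simp
    then have "int_exp m = int_exp (std m) + int (nat c) *s l"
      using c by (simp add: algebra_simps)
    then show ?thesis by blast
  qed
  have reduce_row: "xpow m - xpow (std m) \<in> W" if "weight y m = weight y (std m)" for m
    using same_row[OF that] row_binomial_in_W by blast
  have above_row: "xpow m \<in> W" if "weight y m \<noteq> weight y (std m)" for m
  proof -
    have False if "xpow s \<notin> I" "int_exp m = int_exp s + int k *s l" for s k
    proof -
      have "std m = s"
        using that l_L by (intro std_eqI) (simp_all add: deg_eq_iff scale_L minus_L)
      then show False using that \<open>weight y m \<noteq> weight y (std m)\<close> y_l by (simp add: weight_eq_idot)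
    qed
    then show ?thesis using in_W_or_reduces[of m] by blast
  qed
  show "W \<subseteq> init_ideal y (lattice_ideal L)"
  proof -
    have "(xpow u - xpow v :: ('n, 'k) mpolys) \<in> init_ideal y (lattice_ideal L)"
    proof -
      have "weight y v = weight y u" using y_l by (simp add: weight_eq_idot l_def)
      then show ?thesis
        using init_form_in_init_ideal[OF binomial_in_lattice_ideal[OF deg_v[symmetric]], of y]
          u_neq_v init_form_binomial_homogeneous xpow_diff_eq_0_iff by metis
    qed
    moreover have "(xpow a :: ('n, 'k) mpolys) \<in> init_ideal y (lattice_ideal L)" if a: "a \<in> min_gens I" "a \<noteq> u" for a
    proof -
      \<comment> \<open>In the standard row, \<open>a\<close> would be at least one copy of
        \<open>l\<close> beyond \<open>std a\<close>, hence a multiple of \<open>xpow u\<close>,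
        which is impossible for a minimal generator other than \<open>u\<close>.\<close>
      have "weight y a \<noteq> weight y (std a)"
      proof
        assume "weight y a = weight y (std a)"
        then obtain k where k: "int_exp a = int_exp (std a) + int k *s l" using same_row by blast
        have "k \<noteq> 0"
        proof
          assume "k = 0"
          then have "a = std a" using k by simp
          then show False using a std[of a] by (metis (mono_tags, lifting) mem_Collect_eq min_gens_def)
        qed
        have "u \<le> a"
          unfolding less_eq_vec_def
        proof
          fix i
          have ai: "int (a $ i) = int (std a $ i) + int k * l $ i"
            using arg_cong[OF k, of "\<lambda>x. x $ i"] by simp
          show "u $ i \<le> a $ i"
          proof (cases "u $ i = 0")
            case False
            then have "l $ i = int (u $ i)"
              using min_gen_disjoint[OF u deg_v v, of i] l_nth[of i] by simp
            moreover have "1 * int (u $ i) \<le> int k * int (u $ i)"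
              using \<open>k \<noteq> 0\<close> by (intro mult_right_mono) auto
            ultimately show ?thesis using ai by simp
          qed simp
        qed
        then show False using a u_I by (auto simp: min_gens_def)
      qed
      then have "weight y (std a) < weight y a" using min[of a] by simp
      then have "init_form y (xpow a - xpow (std a) :: ('n, 'k) mpolys) = xpow a" "a \<noteq> std a"
        by (auto simp: init_form_binomial)
      moreover have "(xpow a - xpow (std a) :: ('n, 'k) mpolys) \<in> lattice_ideal L"
        using std(1) by (intro binomial_in_lattice_ideal) simp
      ultimately show ?thesis
        using init_form_in_init_ideal[of _ "lattice_ideal L" y] xpow_diff_eq_0_iff by metis
    qed
    ultimately have "insert (xpow u - xpow v) (xpow ` (min_gens I - {u})) \<subseteq>
        (init_ideal y (lattice_ideal L) :: ('n, 'k) mpolys set)"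
      by blast
    then show ?thesis
      unfolding wall_ideal_def init_ideal_def by (rule ideal_gen_subset)
  qed
  have "init_form y f \<in> W" if f: "f \<in> lattice_ideal L" for f :: "('n, 'k) mpolys"
  proof -
    define T where "T = {m. m \<in> supp f \<and> (\<forall>m'\<in>supp f. weight y m' \<le> weight y m)}"
    define T0 where "T0 = {m\<in>T. weight y m = weight y (std m)}"
    have fin: "finite T" "T0 \<subseteq> T" "finite T0"
      by (auto simp: T_def T0_def intro: finite_subset[OF _ finite_keys[of f]])
    \<comment> \<open>In a fibre that meets \<open>T0\<close>, the top weight is already the least
      weight of the fibre, so all its monomials from \<open>f\<close> belong to \<open>T0\<close>.
      Their coefficients add up to 0, and replacing them by the standard monomial cancels
      everything.\<close>
    have "(\<Sum>m\<in>T0. Poly_Mapping.single (std m) (coef f m)) = 0"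
    proof (rule poly_mapping_eqI)
      fix s
      have "coef (\<Sum>m\<in>T0. Poly_Mapping.single (std m) (coef f m)) s = (\<Sum>m\<in>{m\<in>T0. std m = s}. coef f m)"
        using fin by (simp add: lookup_sum lookup_single when_def sum.inter_filter)
      also have "\<dots> = 0"
      proof (cases "{m\<in>T0. std m = s} = {}")
        case True
        then show ?thesis by (simp only: sum.empty)
      next
        case False
        then obtain m0 where m0: "m0 \<in> T0" "std m0 = s" by blast
        have "m \<in> T0 \<and> std m = s" if "m \<in> supp f" "deg L m = deg L s" for m
        proof -
          have "std m = s" using that std[of m0] m0 by (intro std_eqI) auto
          moreover have "weight y m \<le> weight y m0" using m0 that by (auto simp: T0_def T_def)
          moreover have "weight y m0 = weight y s" using m0 by (auto simp: T0_def)
          moreover have "weight y s \<le> weight y m" using min[of m] \<open>std m = s\<close> by simp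
          ultimately show ?thesis using m0 that by (auto simp: T0_def T_def)
        qed
        then have "{m\<in>T0. std m = s} = {m. m \<in> supp f \<and> deg L m = deg L s}"
          using std(1) by (auto simp: T0_def T_def)
        then show ?thesis using lattice_ideal_fibre_sum[OF f] by simp
      qed
      finally show "coef (\<Sum>m\<in>T0. Poly_Mapping.single (std m) (coef f m)) s = coef 0 s" by simp
    qed
    moreover have "(\<Sum>m\<in>T0. term_of f m - Poly_Mapping.single (std m) (coef f m)) \<in> W"
    proof (rule W_sum)
      fix m assume "m \<in> T0"
      then have "xpow m - xpow (std m) \<in> W" using reduce_row by (auto simp: T0_def)
      from W_mult[OF this, of "Poly_Mapping.single 0 (coef f m)"]
      show "term_of f m - Poly_Mapping.single (std m) (coef f m) \<in> W"
        by (simp add: right_diff_distrib mult_single)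
    qed
    ultimately have "(\<Sum>m\<in>T0. term_of f m) \<in> W" by (simp add: sum_subtractf)
    moreover have "(\<Sum>m\<in>T - T0. term_of f m) \<in> W"
      by (rule W_sum, rule W_single, rule above_row) (auto simp: T0_def)
    moreover have "init_form y f = (\<Sum>m\<in>T - T0. term_of f m) + (\<Sum>m\<in>T0. term_of f m)"
      unfolding init_form_def T_def[symmetric] using fin by (intro sum.subset_diff)
    ultimately show ?thesis using W_add by metis
  qed
  then have "{init_form y f | f. f \<in> lattice_ideal L \<and> f \<noteq> 0} \<subseteq> W" by blast
  then show "init_ideal y (lattice_ideal L) \<subseteq> W"
    unfolding init_ideal_def wall_ideal_def by (rule ideal_gen_subset)
qed

lemma coherent_W:
  assumes "sublattice_of_rank L 2"
  shows "coherent L W"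
proof -
  obtain y where y: "idot y l = 0" "\<And>f. f \<in> L \<Longrightarrow> idot y f = 0 \<Longrightarrow> \<exists>c. f = c *s l"
    by (rule rank_two_functional[OF assms l_L l_neq_0]) (blast intro: l_primitive)+
  have ex_min: "\<exists>f\<in>L. fibre_min L w1 (m + f)" if "0 \<le> m" for m
  proof -
    have m: "int_exp (pos_part m) = m" using that by (rule int_exp_pos_part)
    have "int_exp (std (pos_part m)) - m \<in> L" using std(1)[of "pos_part m"] m by (simp add: deg_eq_iff)
    then show ?thesis
      using std(2)[of "pos_part m"] unfolding std1_iff
      by (intro bexI[of _ "int_exp (std (pos_part m)) - m"]) simp_all
  qed
  interpret flip_lattice L w1 w2 y l
    using l_L ex_min std1_std2 w1_l w2_l l_pos l_neg y by unfold_locales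
  obtain y' where "init_ideal y' (lattice_ideal L) = W"
    using rows_one_sided
  proof
    assume "\<forall>m f. fibre_min L w1 m \<longrightarrow> f \<in> L \<longrightarrow> 0 \<le> m + f \<longrightarrow> 0 \<le> idot y f"
    then show thesis using that init_ideal_eq_W[of y] y by blast
  next
    assume "\<forall>m f. fibre_min L w1 m \<longrightarrow> f \<in> L \<longrightarrow> 0 \<le> m + f \<longrightarrow> idot y f \<le> 0"
    then show thesis using that init_ideal_eq_W[of "- y"] y by simp
  qed
  moreover have "scale_vars (\<chi> i. 1) f = f" for f :: "('n, 'k) mpolys"
    by (simp add: scale_vars_def sum_terms)
  ultimately show ?thesis
    unfolding coherent_def using L_graded_W
    by (intro conjI exI[of _ y'] exI[of _ "\<chi> i. 1"]) simp_all
qed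

end

theorem lemma4p4:
  fixes L :: "(int ^ 'n::finite) set"
    and I J :: "('n, 'k::field) mpolys set"
    and u v :: "nat ^ 'n"
  assumes "infinite (UNIV :: 'k set)"
    and "sublattice_of_rank L 2"
    and "monomial_initial_ideal L I"
    and "monomial_initial_ideal L J"
    and "flip_over L u v I J"
  shows "coherent L (wall_ideal I u v)"
proof -
  interpret int_lattice L using sublattice_int_lattice assms(2) by blast
  obtain w1 where w1: "I = init_ideal w1 (lattice_ideal L)"
    using assms(3) unfolding monomial_initial_ideal_def by blast
  obtain w2 where w2: "J = init_ideal w2 (lattice_ideal L)"
    using assms(4) unfolding monomial_initial_ideal_def by blast
  obtain r where r: "(u, v) \<in> r" "J = init_ideal_order r (wall_ideal I u v)"
    using assms(5) unfolding flip_over_def by blast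
  interpret wall L I J u v w1 w2 r
    using assms(3-5) w1 w2 r
    by unfold_locales (auto simp: monomial_initial_ideal_def flip_over_def)
  show ?thesis using coherent_W assms(2) .
qed

end
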